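(* Let $\overrightarrow{G}$ be a digraph without loops or parallel arcs on $n$ vertices, let $\beta,\gamma$ be real numbers and $H(\overrightarrow{G})=\beta D(\overrightarrow{G})+\gamma A(\overrightarrow{G})$. Let $k$ be an integer. (i) For every vertex $v$ of $\overrightarrow{G}$, \begin{eqnarray*} \Phi_k(H(\overrightarrow{G}),x) &=& (x-\beta d^{+}(v))[\Phi_{k-1}(H_v(\overrightarrow{G})) + \Phi_k(H_v(\overrightarrow{G}))] \\ && +\sum_{\overrightarrow{C}\in \mathcal{C}_{\overrightarrow{G}}(v)} \gamma^{|V(\overrightarrow{C})|}[(-1)^{|V(\overrightarrow{C})|}\Phi_{k-|V(\overrightarrow{C})|}(H_{V(\overrightarrow{C})}(\overrightarrow{G})) - \Phi_k(H_{V(\overrightarrow{C})}(\overrightarrow{G}))]. \end{eqnarray*} (ii) For every arc $\overrightarrow{e}=(v,u)$ of $\overrightarrow{G}$, \begin{eqnarray*} \Phi_k(H(\overrightarrow{G}),x) &=& \Phi_k(H(\overrightarrow{G}-\overrightarrow{e}),x) - \beta[\Phi_k(H_v(\overrightarrow{G}-\overrightarrow{e})) + \Phi_{k-1}(H_v(\overrightarrow{G}-\overrightarrow{e}))] \\ && + \sum_{\overrightarrow{C}\in \mathcal{C}_{\overrightarrow{G}}(\overrightarrow{e})} \gamma^{|V(\overrightarrow{C})|}[(-1)^{|V(\overrightarrow{C})|}\Phi_{k-|V(\overrightarrow{C})|}(H_{V(\overrightarrow{C})}(\overrightarrow{G})) - \Phi_k(H_{V(\overrightarrow{C})}(\overrightarrow{G}))].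 \end{eqnarray*}
   Context: For an $m\times m$ matrix $M=(m_{ij})$ and an integer $j$ with $1\le j\le m$, the hook immanant is $d_j(M)=\sum_{\sigma\in S_m}\chi_{(j,1^{m-j})}(\sigma)\prod_{i=1}^m m_{i\sigma(i)}$, where $\chi_{(j,1^{m-j})}$ is the irreducible character of $S_m$ indexed by the hook partition $(j,1^{m-j})$; by convention $d_j(M)=0$ if $j<1$ or $j>m$. The hook immanantal polynomial is $\Phi_j(M,x)=d_j(xI_m-M)$, abbreviated $\Phi_j(M)$. For a digraph $\overrightarrow{G}$ with vertices $v_1,\dots,v_n$, $A(\overrightarrow{G})=(a_{ij})$ with $a_{ij}=1$ if $(v_i,v_j)$ is an arc and $0$ otherwise, and $D(\overrightarrow{G})=\mathrm{diag}(d^+(v_1),\dots,d^+(v_n))$ where $d^+$ denotes out-degree; $H(\overrightarrow{G})=\beta D(\overrightarrow{G})+\gamma A(\overrightarrow{G})$. For a vertex subset $S$, $H_S(\overrightarrow{G})$ is the principal submatrix of $H(\overrightarrow{G})$ obtained by deleting the rows and columns indexed by $S$; $H_v=H_{\{v\}}$. $\overrightarrow{G}-\overrightarrow{e}$ is obtained by deleting the arc $\overrightarrow{e}$ and keeping all vertices. A consistently directed cycle is a directed cycle all of whose arcs follow one consistent direction; $\mathcal{C}_{\overrightarrow{G}}(v)$ (resp. $\mathcal{C}_{\overrightarrow{G}}(\overrightarrow{e})$) is the set of consistently directed cycles of $\overrightarrow{G}$ containing the vertex $v$ (resp. the arc $\overrightarrow{e}$), and $|V(\overrightarrow{C})|$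 is the number of vertices of $\overrightarrow{C}$.
   Formalization: For the 0×0 matrix (a Hamiltonian cycle, or n=1) the convention d_j=0 makes the claim false (directed 2-cycle, β=0, γ=1, k=2: x²+1 against x²); here d_j of the empty matrix is (-1)^j for j≤0 and 0 for j>0; all other matrices follow the stated convention. *)

theory Defs
  imports
    "HOL-Library.Function_Algebras"
    "HOL-Combinatorics.Permutations"
    "Jordan_Normal_Form.DL_Submatrix"
    "Graph_Theory.Graph_Theory"
begin

section \<open>Characters of the symmetric group\<close>

interpretation fun_vs: Vector_Spaces.vector_space
  "\<lambda>(c::real) (f :: 'a \<Rightarrow> real) x. c * f x"
  by unfold_locales (auto simp: fun_eq_iff algebra_simps)

text \<open>The trace of a linear map \<open>T\<close> on a finite-dimensional \<open>T\<close>-invariant subspace \<open>V\<close>;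
  it does not depend on the basis that is chosen.\<close>

definition trace_on :: "('a \<Rightarrow> real) set \<Rightarrow> (('a \<Rightarrow> real) \<Rightarrow> 'a \<Rightarrow> real) \<Rightarrow> real" where
  "trace_on V T =
    (let B = (SOME B. B \<subseteq> V \<and> fun_vs.independent B \<and> V \<subseteq> fun_vs.span B)
     in \<Sum>b\<in>B. fun_vs.representation B (T b) b)"

text \<open>A partition is the list of its parts. The symmetric group \<open>S\<^sub>m\<close> acts on \<open>{0..<m}\<close>.\<close>

definition cells :: "nat list \<Rightarrow> (nat \<times> nat) set" where
  "cells lam = {(r, c). r < length lam \<and> c < lam ! r}"

definition is_tableau :: "nat list \<Rightarrow> (nat \<times> nat \<Rightarrow> nat) \<Rightarrow> bool" where
  "is_tableau lam t \<longleftrightarrow> bij_betw t (cells lam) {0..<sum_list lam}"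

text \<open>A tabloid, i.e. a class of tableaux up to row equivalence, is encoded as the list of its
  row sets. Elements of the permutation module on tabloids are real functions on such lists.\<close>

definition tabloid :: "nat list \<Rightarrow> (nat \<times> nat \<Rightarrow> nat) \<Rightarrow> nat set list" where
  "tabloid lam t = map (\<lambda>r. {t (r, c) |c. c < lam ! r}) [0..<length lam]"

definition column_stabilizer :: "nat list \<Rightarrow> (nat \<times> nat \<Rightarrow> nat) \<Rightarrow> (nat \<Rightarrow> nat) set" where
  "column_stabilizer lam t =
    {p. p permutes {0..<sum_list lam} \<and>
        (\<forall>(r, c)\<in>cells lam. \<exists>r'. (r', c) \<in> cells lam \<and> p (t (r, c)) = t (r', c))}"

definition polytabloid :: "nat list \<Rightarrow> (nat \<times> nat \<Rightarrow> nat) \<Rightarrow> nat set list \<Rightarrow> real" where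
  "polytabloid lam t =
    (\<lambda>X. \<Sum>p\<in>column_stabilizer lam t. if X = tabloid lam (p \<circ> t) then of_int (sign p) else 0)"

definition specht_module :: "nat list \<Rightarrow> (nat set list \<Rightarrow> real) set" where
  "specht_module lam = fun_vs.span {polytabloid lam t |t. is_tableau lam t}"

definition perm_act :: "(nat \<Rightarrow> nat) \<Rightarrow> (nat set list \<Rightarrow> real) \<Rightarrow> nat set list \<Rightarrow> real" where
  "perm_act s f = (\<lambda>X. f (map ((`) (inv_into UNIV s)) X))"

definition irr_char :: "nat list \<Rightarrow> (nat \<Rightarrow> nat) \<Rightarrow> real" where
  "irr_char lam s = trace_on (specht_module lam) (perm_act s)"

section \<open>Hook immanants\<close>

definition hook :: "nat \<Rightarrow> nat \<Rightarrow> nat list" where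
  "hook j m = j # replicate (m - j) 1"

text \<open>For \<open>m \<ge> 1\<close> the value is \<open>0\<close> outside \<open>1 \<le> j \<le> m\<close>. The empty matrix (\<open>m = 0\<close>) has no
  hook at all. Its value is read off from the usual straightening rule
  \<open>\<chi>(\<dots>,a,b,\<dots>) = - \<chi>(\<dots>,b-1,a+1,\<dots>)\<close> for characters indexed by integer sequences: it sends
  \<open>(j,1\<^sup>m\<^sup>-\<^sup>j)\<close> with \<open>j \<le> 0\<close> to \<open>0\<close> if \<open>m \<ge> 1\<close>, and to \<open>(-1)\<^sup>j\<close> times the character of the
  empty partition if \<open>m = 0\<close>. With the value \<open>0\<close> for the empty matrix, the expansions along a
  vertex or an arc would lose the contribution of the Hamiltonian cycles.\<close>

definition hook_immanant :: "int \<Rightarrow> real mat \<Rightarrow> real" where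
  "hook_immanant j M =
    (let m = dim_row M in
     if 1 \<le> j \<and> j \<le> int m then
       \<Sum>s | s permutes {0..<m}. irr_char (hook (nat j) m) s * (\<Prod>i = 0..<m. M $$ (i, s i))
     else if m = 0 \<and> j \<le> 0 then (-1) ^ nat (- j)
     else 0)"

definition hook_poly :: "int \<Rightarrow> real mat \<Rightarrow> real \<Rightarrow> real" where
  "hook_poly j M x = hook_immanant j (x \<cdot>\<^sub>m 1\<^sub>m (dim_row M) - M)"

section \<open>Matrices and cycles of a digraph\<close>

text \<open>The list \<open>vs\<close> enumerates the vertices.\<close>

definition adj_mat :: "('a, 'b) pre_digraph \<Rightarrow> 'a list \<Rightarrow> real mat" where
  "adj_mat G vs = mat (length vs) (length vs)
    (\<lambda>(i, j). if (vs ! i, vs ! j) \<in> arcs_ends G then 1 else 0)"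

definition out_deg_mat :: "('a, 'b) pre_digraph \<Rightarrow> 'a list \<Rightarrow> real mat" where
  "out_deg_mat G vs = mat_diag (length vs) (\<lambda>i. real (out_degree G (vs ! i)))"

definition H_mat :: "real \<Rightarrow> real \<Rightarrow> ('a, 'b) pre_digraph \<Rightarrow> 'a list \<Rightarrow> real mat" where
  "H_mat \<beta> \<gamma> G vs = \<beta> \<cdot>\<^sub>m out_deg_mat G vs + \<gamma> \<cdot>\<^sub>m adj_mat G vs"

definition H_del :: "real \<Rightarrow> real \<Rightarrow> ('a, 'b) pre_digraph \<Rightarrow> 'a list \<Rightarrow> 'a set \<Rightarrow> real mat" where
  "H_del \<beta> \<gamma> G vs S =
    (let I = {i. i < length vs \<and> vs ! i \<notin> S} in submatrix (H_mat \<beta> \<gamma> G vs) I I)"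

text \<open>Closed walks that differ by a rotation are the same cycle, so a cycle is represented by
  its set of arcs.\<close>

definition dicycles :: "('a, 'b) pre_digraph \<Rightarrow> 'b set set" where
  "dicycles G = {set p |p. pre_digraph.cycle G p}"

definition cycle_verts :: "('a, 'b) pre_digraph \<Rightarrow> 'b set \<Rightarrow> 'a set" where
  "cycle_verts G C = tail G ` C"

definition cycles_at_vertex :: "('a, 'b) pre_digraph \<Rightarrow> 'a \<Rightarrow> 'b set set" where
  "cycles_at_vertex G v = {C \<in> dicycles G. v \<in> cycle_verts G C}"

definition cycles_at_arc :: "('a, 'b) pre_digraph \<Rightarrow> 'b \<Rightarrow> 'b set set" where
  "cycles_at_arc G e = {C \<in> dicycles G. e \<in> C}"

end

theory Submission
  imports Defs "HOL-Combinatorics.Cycles"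
begin

text \<open>The Specht module of the hook \<open>(j, 1\<^sup>r)\<close> with \<open>r = m - j\<close> is the image of the boundary map
  from the exterior power \<open>\<Lambda>\<^sup>r\<^sup>+\<^sup>1\<close> to \<open>\<Lambda>\<^sup>r\<close> of the permutation module, and the complex of these
  exterior powers is exact. Hence the characters of the hooks with legs \<open>r\<close> and \<open>r + 1\<close> add up to
  the character of \<open>\<Lambda>\<^sup>r\<^sup>+\<^sup>1\<close>, and the latter counts invariant subsets with sign. Consequently,
  splitting off a cycle of length \<open>l\<close> multiplies the generating function of the hook characters
  by \<open>1 - (-q) ^ l\<close>, that is
  \<open>\<chi>\<^sub>k(c t) = \<chi>\<^sub>k\<^sub>-\<^sub>l(t) - (-1) ^ l \<chi>\<^sub>k(t)\<close>. Grouping the permutations in the immanant by their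
  cycle through \<open>v\<close> gives the expansion along a vertex. The expansion along an arc \<open>(v, u)\<close> is the
  difference of the vertex expansions at \<open>v\<close> with and without the arc.\<close>

section \<open>Traces\<close>

text \<open>Boundaries appear because a hook tabloid is determined by the word of its leg, while the
  column stabilizer antisymmetrizes over the corner and the leg together: each permutation of the
  first column shows all of its letters except the one in the corner. Exactness comes from the base
  point 0. Wedging with 0 is a contracting homotopy, hence the bases indexed by sets that avoid 0.
  The exterior powers have the generating function det(1 + q s), the product of the factors 1 - (-q)
  ^ l over the cycles of s, and the relation between neighbouring legs divides it by 1 + q. On a
  nonempty set some factor absorbs the division, the quotient is a polynomial, and this gives the
  vanishing outside 1 \<le> k \<le> m. On the empty set the whole series 1 / (1 + q) remains. Its
  coefficients are the values chosen for the empty matrix, and they are what a Hamiltonian cycle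
  leaves behind when it is split off.\<close>

abbreviation (input) scale_fun :: "real \<Rightarrow> ('a \<Rightarrow> real) \<Rightarrow> 'a \<Rightarrow> real" where
  "scale_fun c f \<equiv> (\<lambda>x. c * f x)"

lemma sum_fun_apply: "(\<Sum>i\<in>I. f i) x = (\<Sum>i\<in>I. f i x :: real)"
  by (induction I rule: infinite_finite_induct) auto

text \<open>Linearity is asked for on V only, because the coordinates
  \<open>fun_vs.representation B\<close> are additive only on the span of B.\<close>

definition lin_on :: "('a \<Rightarrow> real) set \<Rightarrow> (('a \<Rightarrow> real) \<Rightarrow> real) \<Rightarrow> bool" where
  "lin_on V p \<longleftrightarrow> (\<forall>f\<in>V. \<forall>g\<in>V. p (f + g) = p f + p g) \<and> (\<forall>c. \<forall>f\<in>V. p (scale_fun c f) = c * p f)"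

lemma lin_on_sum:
  assumes "lin_on V p" "fun_vs.subspace V" "\<And>i. i \<in> I \<Longrightarrow> g i \<in> V" 
  shows "p (\<Sum>i\<in>I. scale_fun (c i) (g i)) = (\<Sum>i\<in>I. c i * p (g i))"
proof -
  have p0: "p 0 = 0"
    using assms(1) fun_vs.subspace_0[OF assms(2)] unfolding lin_on_def
    by (metis add_cancel_left_left)
  show ?thesis using assms(3)
  proof (induction I rule: infinite_finite_induct)
    case (insert x F)
    have "scale_fun (c x) (g x) \<in> V" "(\<Sum>i\<in>F. scale_fun (c i) (g i)) \<in> V"
      using insert.prems assms(2)
      by (auto intro!: fun_vs.subspace_sum fun_vs.subspace_scale)
    then have "p (scale_fun (c x) (g x) + (\<Sum>i\<in>F. scale_fun (c i) (g i)))
        = c x * p (g x) + p (\<Sum>i\<in>F. scale_fun (c i) (g i))"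
      using insert.prems assms(1) unfolding lin_on_def by simp
    with insert show ?case by (simp del: plus_fun_apply plus_fun_def)
  qed (use p0 in \<open>auto simp: zero_fun_def\<close>)
qed

text \<open>The identity of V written as a finite sum of tensors of \<open>p i\<close> and
  \<open>e i\<close>. Contracting this tensor with T gives the trace.\<close>

definition reproducing ::
  "('a \<Rightarrow> real) set \<Rightarrow> 'i set \<Rightarrow> ('i \<Rightarrow> 'a \<Rightarrow> real) \<Rightarrow> ('i \<Rightarrow> ('a \<Rightarrow> real) \<Rightarrow> real) \<Rightarrow> bool" where
  "reproducing V I e p \<longleftrightarrow> finite I \<and> (\<forall>i\<in>I. e i \<in> V \<and> lin_on V (p i)) \<and>
     (\<forall>f\<in>V. f = (\<Sum>i\<in>I. scale_fun (p i f) (e i)))"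

text \<open>Traces can be computed from any reproducing system, linearly independent or not: expand
  \<open>T (e i)\<close> in the second system and exchange the two sums.\<close>

lemma reproducing_trace_eq:
  assumes V: "fun_vs.subspace V" and T: "\<And>f. f \<in> V \<Longrightarrow> T f \<in> V"
    and lin: "\<And>x. lin_on V (\<lambda>f. T f x)"
    and 1: "reproducing V I e p" and 2: "reproducing V J e' q"
  shows "(\<Sum>i\<in>I. p i (T (e i))) = (\<Sum>j\<in>J. q j (T (e' j)))"
proof -
  have T_sum: "T (\<Sum>i\<in>I. scale_fun (c i) (e i)) = (\<Sum>i\<in>I. scale_fun (c i) (T (e i)))" for c
    by (rule ext, subst lin_on_sum[OF lin V]) (use 1 in \<open>auto simp: reproducing_def sum_fun_apply\<close>)
  have "p i (T (e i)) = (\<Sum>j\<in>J. q j (T (e i)) * p i (e' j))" if "i \<in> I" for i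
  proof -
    have "T (e i) = (\<Sum>j\<in>J. scale_fun (q j (T (e i))) (e' j))"
      using 1 2 T that unfolding reproducing_def by blast
    then have "p i (T (e i)) = p i (\<Sum>j\<in>J. scale_fun (q j (T (e i))) (e' j))" by simp
    also have "\<dots> = (\<Sum>j\<in>J. q j (T (e i)) * p i (e' j))"
      by (rule lin_on_sum[OF _ V]) (use 1 2 that in \<open>auto simp: reproducing_def\<close>)
    finally show ?thesis .
  qed
  then have "(\<Sum>i\<in>I. p i (T (e i))) = (\<Sum>j\<in>J. \<Sum>i\<in>I. q j (T (e i)) * p i (e' j))"
    by (subst sum.swap) simp
  also have "\<dots> = (\<Sum>j\<in>J. q j (T (e' j)))"
  proof (rule sum.cong[OF refl])
    fix j assume j: "j \<in> J"
    have "e' j = (\<Sum>i\<in>I. scale_fun (p i (e' j)) (e i))"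
      using 1 2 j unfolding reproducing_def by blast
    then have "T (e' j) = (\<Sum>i\<in>I. scale_fun (p i (e' j)) (T (e i)))"
      using T_sum by metis
    then have "q j (T (e' j)) = q j (\<Sum>i\<in>I. scale_fun (p i (e' j)) (T (e i)))" by simp
    also have "\<dots> = (\<Sum>i\<in>I. p i (e' j) * q j (T (e i)))"
      by (rule lin_on_sum[OF _ V]) (use 1 2 j T in \<open>auto simp: reproducing_def\<close>)
    finally show "(\<Sum>i\<in>I. q j (T (e i)) * p i (e' j)) = q j (T (e' j))"
      by (simp add: mult.commute)
  qed
  finally show ?thesis .
qed

text \<open>The basis picked by \<open>SOME\<close> is itself a reproducing system with its
  coordinate functionals, so the exchange of sums removes the dependence on the choice.\<close>

lemma trace_on_reproducing:
  assumes V: "fun_vs.subspace V" and T: "\<And>f. f \<in> V \<Longrightarrow> T f \<in> V"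
    and lin: "\<And>x. lin_on V (\<lambda>f. T f x)"
    and 1: "reproducing V I e p"
  shows "trace_on V T = (\<Sum>i\<in>I. p i (T (e i)))"
proof -
  define P where "P = (\<lambda>B. B \<subseteq> V \<and> fun_vs.independent B \<and> V \<subseteq> fun_vs.span B)"
  define B where "B = (SOME B. P B)"
  have "\<exists>B. P B" unfolding P_def using fun_vs.maximal_independent_subset[of V] by metis
  then have B: "B \<subseteq> V" "fun_vs.independent B" "V \<subseteq> fun_vs.span B"
    using someI_ex[of P] unfolding B_def P_def by blast+
  have span: "fun_vs.span B = V" using B V fun_vs.span_minimal by blast
  have "V \<subseteq> fun_vs.span (e ` I)"
  proof
    fix f assume "f \<in> V"
    then have "f = (\<Sum>i\<in>I. scale_fun (p i f) (e i))" using 1 unfolding reproducing_def by blast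
    also have "\<dots> \<in> fun_vs.span (e ` I)"
      by (intro fun_vs.span_sum fun_vs.span_scale fun_vs.span_base) auto
    finally show "f \<in> fun_vs.span (e ` I)" .
  qed
  then have fin: "finite B"
    using fun_vs.independent_span_bound[of "e ` I" B] 1 B unfolding reproducing_def by blast
  have "reproducing V B (\<lambda>b. b) (\<lambda>b f. fun_vs.representation B f b)"
    unfolding reproducing_def lin_on_def
    using fin B span fun_vs.representation_add[OF B(2)] fun_vs.representation_scale[OF B(2)]
      fun_vs.sum_representation_eq[OF B(2) _ fin order_refl]
    by auto
  from reproducing_trace_eq[OF V T lin this 1]
  show ?thesis unfolding trace_on_def Let_def B_def P_def by simp
qed

section \<open>Hook characters of permutations\<close>

lemma perm_restrict_permutes:
  assumes "s permutes S" "s ` A = A"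
  shows "perm_restrict s A permutes A"
proof (rule bij_imp_permutes)
  have "inj_on s A" using assms(1) permutes_inj inj_on_subset by blast
  then show "bij_betw (perm_restrict s A) A A"
    using assms(2) by (simp add: bij_betw_def perm_restrict_def inj_on_def)
qed (simp add: perm_restrict_def)

lemma sign_cycle_of_list:
  assumes "distinct cs" "cs \<noteq> []"
  shows "sign (cycle_of_list cs) = - ((-1) ^ length cs)"
  using assms
proof (induction cs rule: cycle_of_list.induct)
  case (1 i j cs)
  then show ?case
    by (simp add: sign_compose permutation_of_cycle permutation_swap_id sign_swap_id del: comp_apply o_apply)
qed (auto simp: sign_id)

text \<open>\<open>support c x\<close> lists the single orbit in the order in which c traverses it,
  which reduces the sign to that of \<open>cycle_of_list\<close>.\<close>

lemma sign_cyclic_on: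
  assumes "c permutes C" "finite C" "cyclic_on c C"
  shows "sign c = - ((-1) ^ card C)"
proof -
  have perm: "permutation c" using assms permutation_permutes by blast
  obtain x where x: "x \<in> C" "C = orbit c x" using assms(3) unfolding cyclic_on_def by blast
  let ?L = "support c x"
  have set: "set ?L = C"
    using x(2) support_set[OF perm, of x] orbit_altdef_permutation[OF perm, of x] by auto
  have dist: "distinct ?L" using cycle_of_permutation[OF perm] .
  have "c y = cycle_of_list ?L y" for y
    using cycle_restrict[OF perm, of y x] id_outside_supp[of y ?L] set assms(1)
    by (metis permutes_not_in)
  then have eq: "c = cycle_of_list ?L" by blast
  have ne: "?L \<noteq> []" using set x(1) by (metis empty_iff list.set(1))
  have "length ?L = card C" using set dist distinct_card by metis
  then show ?thesis using sign_cycle_of_list[OF dist ne] eq by metis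
qed

text \<open>If \<open>s\<close> has cycle lengths \<open>l\<^sub>1, l\<^sub>2, \<dots>\<close> on \<open>S\<close>, then \<open>hook_char S s k\<close> is the coefficient of
  \<open>q ^ (card S - k)\<close> in \<open>(\<Prod>i. 1 - (-q) ^ l\<^sub>i) / (1 + q)\<close>; the sum over the invariant sets \<open>A\<close>
  comes from multiplying out the product. Unlike the character it makes sense for every integer
  \<open>k\<close> and for empty \<open>S\<close>, so that the recursion over the cycles needs no case distinctions.\<close>

definition hook_char :: "'a set \<Rightarrow> ('a \<Rightarrow> 'a) \<Rightarrow> int \<Rightarrow> real" where
  "hook_char S s k = (\<Sum>A | A \<subseteq> S \<and> s ` A = A \<and> k \<le> int (card (S - A)).
     (-1) ^ nat (int (card (S - A)) - k) * of_int (sign (perm_restrict s A)))"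

text \<open>One common point drags its whole orbit into the invariant set.\<close>

lemma cyclic_on_subset_or_disjoint:
  assumes "cyclic_on c C" "\<And>x. x \<in> C \<Longrightarrow> s x = c x" "s ` A = A"
  shows "C \<subseteq> A \<or> A \<inter> C = {}"
proof -
  have "C \<subseteq> A" if x: "x \<in> A" "x \<in> C" for x
  proof
    fix y assume "y \<in> C"
    then have "y \<in> orbit c x" using assms(1) x unfolding cyclic_on_alldef by blast
    then have "y \<in> C \<and> y \<in> A"
    proof induction
      case base
      then show ?case using assms x
        by (metis cyclic_on_alldef image_eqI orbit.base)
    next
      case (step y)
      then show ?case using assms
        by (metis cyclic_on_alldef image_eqI orbit.base)
    qed
    then show "y \<in> A" by blast
  qed
  then show ?thesis by blast
qed

text \<open>The factor 1 - (-q) ^ l of the cycle C is multiplied out. Invariant sets that avoid C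
  belong to the term 1; their complement loses the l points of C, which shifts k by l. Invariant
  sets that contain C belong to the other term; their complement is unchanged and the sign of the
  cycle contributes - ((-1) ^ l).\<close>

lemma hook_char_cycle:
  assumes fin: "finite S" and C: "C \<subseteq> S" "c permutes C" "cyclic_on c C" and t: "t permutes (S - C)"
  shows "hook_char S (c \<circ> t) k
    = hook_char (S - C) t (k - int (card C)) - (-1) ^ card C * hook_char (S - C) t k"
proof -
  have finC: "finite C" using fin C(1) finite_subset by blast
  define s where "s = c \<circ> t"
  have s: "s x = c x" if "x \<in> C" for x
    using that t unfolding s_def by (simp add: permutes_not_in)
  have s': "s x = t x" if "x \<notin> C" for x
  proof -
    have "t x \<notin> C" using that t
      by (metis DiffD2 DiffI Un_Diff_cancel Un_iff permutes_in_image permutes_not_in)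
    then show ?thesis using C(2) unfolding s_def by (simp add: permutes_not_in)
  qed
  define g where "g S' s' k' A = (-1) ^ nat (int (card (S' - A)) - k') * real_of_int (sign (perm_restrict s' A))"
    for S' :: "'a set" and s' k' A
  let ?P = "{A. A \<subseteq> S \<and> s ` A = A \<and> k \<le> int (card (S - A))}"
  let ?Q = "\<lambda>k. {A. A \<subseteq> S - C \<and> t ` A = A \<and> k \<le> int (card (S - C - A))}"
  have finP: "finite ?P" "finite (?Q k)" for k
    using fin by (auto intro: finite_subset[OF _ finite_Pow_iff[THEN iffD2]])
  have card1: "int (card (S - A)) = int (card C) + int (card (S - C - A))" if "A \<subseteq> S - C" for A
  proof -
    have "S - A = C \<union> (S - C - A)" "C \<inter> (S - C - A) = {}" using that C(1) by auto
    then show ?thesis using fin finC by (metis card_Un_disjoint finite_Diff of_nat_add)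
  qed
  have img1: "s ` A = t ` A" if "A \<subseteq> S - C" for A
    using that s' by (intro image_cong) auto
  have cC: "c ` C = C" using C(2) by (rule permutes_image)
  have img2: "s ` (C \<union> A) = C \<union> t ` A" if "A \<subseteq> S - C" for A
    using img1[OF that] s cC by (auto simp: image_Un)
  have tA: "t ` A \<subseteq> S - C" if "A \<subseteq> S - C" for A
    using that t by (metis image_mono permutes_image)
  have P: "?P = ?Q (k - int (card C)) \<union> (\<lambda>A. C \<union> A) ` ?Q k" (is "_ = ?Q1 \<union> ?Q2")
  proof (intro equalityI subsetI)
    fix A assume A: "A \<in> ?P"
    then consider "C \<subseteq> A" | "A \<inter> C = {}"
      using cyclic_on_subset_or_disjoint[OF C(3) s] by blast
    then show "A \<in> ?Q1 \<union> ?Q2"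
    proof cases
      case 1
      define B where "B = A - C"
      have B: "A = C \<union> B" "B \<subseteq> S - C" using 1 A unfolding B_def by auto
      have "C \<union> t ` B = C \<union> B" using A img2[OF B(2)] B(1) by auto
      then have "t ` B = B" using tA[OF B(2)] B(2) by blast
      moreover have "S - A = S - C - B" using B by auto
      ultimately show ?thesis using B A by auto
    next
      case 2
      then have "A \<subseteq> S - C" using A by auto
      then show ?thesis using A img1 card1 by auto
    qed
  next
    fix A assume "A \<in> ?Q1 \<union> ?Q2"
    then show "A \<in> ?P"
    proof
      assume "A \<in> ?Q1" then show ?thesis using img1 card1 by auto
    next
      assume "A \<in> ?Q2"
      then obtain B where B: "B \<in> ?Q k" "A = C \<union> B" by blast
      have "S - A = S - C - B" using B by auto
      then show ?thesis using B img2[of B] C(1) by auto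
    qed
  qed
  have disj: "?Q1 \<inter> ?Q2 = {}" using C(3) unfolding cyclic_on_alldef by auto
  have inj: "inj_on (\<lambda>A. C \<union> A) (?Q k)" by (auto simp: inj_on_def)
  have g1: "g S s k A = g (S - C) t (k - int (card C)) A" if "A \<in> ?Q1" for A
  proof -
    have "perm_restrict s A = perm_restrict t A"
      using that s' by (auto simp: perm_restrict_def fun_eq_iff)
    then show ?thesis using card1[of A] that unfolding g_def by (simp add: algebra_simps)
  qed
  have g2: "g S s k (C \<union> A) = - ((-1) ^ card C) * g (S - C) t k A" if A: "A \<in> ?Q k" for A
  proof -
    have "perm_restrict t A permutes A" using perm_restrict_permutes[OF t] A by blast
    moreover have "finite A" using A fin finite_subset by blast
    ultimately have "permutation (perm_restrict t A)" using permutation_permutes by blast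
    moreover have "permutation c" using C(2) finC permutation_permutes by blast
    moreover have "perm_restrict s (C \<union> A) = c \<circ> perm_restrict t A"
    proof
      fix x
      consider "x \<in> C" | "x \<in> A" "x \<notin> C" | "x \<notin> A" "x \<notin> C" by blast
      then show "perm_restrict s (C \<union> A) x = (c \<circ> perm_restrict t A) x"
      proof cases
        case 1
        then have "x \<notin> A" using A by auto
        then show ?thesis using 1 s by (simp add: perm_restrict_def)
      next
        case 2
        then show ?thesis by (simp add: perm_restrict_def s_def)
      next
        case 3
        then show ?thesis using C(2) by (simp add: perm_restrict_def permutes_not_in)
      qed
    qed
    ultimately have "sign (perm_restrict s (C \<union> A)) = - ((-1) ^ card C) * sign (perm_restrict t A)"
      using sign_compose sign_cyclic_on[OF C(2) finC C(3)] by metis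
    moreover have "S - (C \<union> A) = S - C - A" by auto
    ultimately show ?thesis unfolding g_def by simp
  qed
  have "hook_char S s k = sum (g S s k) (?Q1 \<union> ?Q2)"
    unfolding hook_char_def g_def P[symmetric] ..
  also have "\<dots> = sum (g S s k) ?Q1 + sum (g S s k) ?Q2"
    by (rule sum.union_disjoint) (use finP disj in auto)
  also have "sum (g S s k) ?Q1 = hook_char (S - C) t (k - int (card C))"
    unfolding hook_char_def by (rule sum.cong[OF refl], subst g1) (auto simp: g_def)
  also have "sum (g S s k) ?Q2 = - ((-1) ^ card C) * hook_char (S - C) t k"
    unfolding hook_char_def sum_distrib_left
    by (subst sum.reindex[OF inj], rule sum.cong[OF refl], unfold o_def, subst g2) (auto simp: g_def)
  finally have "hook_char S s k
    = hook_char (S - C) t (k - int (card C)) - (-1) ^ card C * hook_char (S - C) t k" by simp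
  then show ?thesis unfolding s_def .
qed

text \<open>Supplies the cycle to be split off, both for the vanishing of \<open>hook_char\<close>
  at nonpositive k and for the bijection in \<open>hook_imm_expand\<close>.\<close>

lemma orbit_decompose:
  assumes "finite S" "s permutes S" "v \<in> S"
  defines "C \<equiv> orbit s v"
  shows "v \<in> C" "C \<subseteq> S" "perm_restrict s C permutes C" "orbit (perm_restrict s C) v = C"
    "perm_restrict s (S - C) permutes (S - C)"
    "perm_restrict s C \<circ> perm_restrict s (S - C) = s"
proof -
  have perm: "permutation s" using assms permutation_permutes by blast
  show v: "v \<in> C" unfolding C_def by (rule permutation_self_in_orbit[OF perm])
  show CS: "C \<subseteq> S" unfolding C_def using assms(2,3) permutes_orbit_subset by fast
  have cyc: "cyclic_on s C" unfolding C_def by (rule cyclic_on_orbit'[OF perm])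
  have img: "s ` C = C"
  proof
    show "s ` C \<subseteq> C" unfolding C_def by (auto intro: orbit.step)
    show "C \<subseteq> s ` C"
      using cyclic_on_f_in[OF assms(2) cyc] permutes_surj[OF assms(2)] by (metis image_iff subsetI surjD)
  qed
  show p1: "perm_restrict s C permutes C" by (rule perm_restrict_permutes[OF assms(2) img])
  have "cyclic_on (perm_restrict s C) C" using cyc by (simp add: cyclic_on_perm_restrict)
  then show "orbit (perm_restrict s C) v = C" using v unfolding cyclic_on_alldef by simp
  show p2: "perm_restrict s (S - C) permutes (S - C)"
    by (rule perm_restrict_diff_cyclic[OF assms(2) cyc])
  have "perm_restrict s C \<circ> perm_restrict s (S - C) = perm_restrict s (C \<union> (S - C))"
    by (rule perm_restrict_union[OF p1 p2]) auto
  also have "C \<union> (S - C) = S" using CS by auto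
  finally show "perm_restrict s C \<circ> perm_restrict s (S - C) = s"
    unfolding perm_restrict_id[OF assms(2)] .
qed

text \<open>For k \<le> 0 the bound on k in the sum excludes no invariant set, so lowering k by the
  length l of a cycle merely multiplies every term by (-1) ^ l. The two terms of
  \<open>hook_char_cycle\<close> then cancel.\<close>

lemma hook_char_nonpos:
  assumes "finite S" "s permutes S" "S \<noteq> {}" "k \<le> 0"
  shows "hook_char S s k = 0"
proof -
  obtain v where v: "v \<in> S" using assms by blast
  define C where "C = orbit s v"
  define t where "t = perm_restrict s (S - C)"
  note d = orbit_decompose[OF assms(1,2) v, folded C_def, folded t_def]
  have cyc: "cyclic_on (perm_restrict s C) C" using d unfolding cyclic_on_def by blast
  have "hook_char (S - C) t (k - int (card C)) = (-1) ^ card C * hook_char (S - C) t k"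
    unfolding hook_char_def sum_distrib_left
  proof (rule sum.cong)
    fix A assume "A \<in> {A. A \<subseteq> S - C \<and> t ` A = A \<and> k \<le> int (card (S - C - A))}"
    have "nat (int (card (S - C - A)) - (k - int (card C)))
        = card C + nat (int (card (S - C - A)) - k)" using assms(4) by linarith
    then show "(-1) ^ nat (int (card (S - C - A)) - (k - int (card C))) * real_of_int (sign (perm_restrict t A))
      = (-1) ^ card C * ((-1) ^ nat (int (card (S - C - A)) - k) * real_of_int (sign (perm_restrict t A)))"
      by (simp add: power_add)
  qed (use assms(4) in auto)
  then show ?thesis
    using hook_char_cycle[OF assms(1) d(2,3) cyc d(5), of k] d(6) by simp
qed

lemma hook_char_greater:
  assumes "finite S" "k > int (card S)"
  shows "hook_char S s k = 0"
proof -
  have "card (S - A) \<le> card S" for A using assms(1) by (simp add: card_mono)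
  then have "{A. A \<subseteq> S \<and> s ` A = A \<and> k \<le> int (card (S - A))} = {}"
    using assms(2) by (auto simp: not_le) (meson le_less_trans not_le of_nat_mono)
  then show ?thesis unfolding hook_char_def by (metis (lifting) sum.empty)
qed

section \<open>Alternating functions\<close>

text \<open>For \<open>xs\<close> enumerating \<open>X\<close> this is the coefficient of \<open>ys\<close> in the wedge product of \<open>xs\<close>; if \<open>xs\<close>
  misses one element \<open>z\<close> of \<open>X\<close>, it is the coefficient of \<open>ys\<close> in the boundary of the wedge
  product of \<open>z # xs\<close>.\<close>

definition alt_sum :: "'a set \<Rightarrow> 'a list \<Rightarrow> 'a list \<Rightarrow> real" where
  "alt_sum X xs ys = (\<Sum>p | p permutes X \<and> map p xs = ys. of_int (sign p))"

lemma alt_sum_nonzeroE: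
  assumes "alt_sum X xs ys \<noteq> 0"
  obtains p where "p permutes X" "map p xs = ys"
  using assms unfolding alt_sum_def by (metis (mono_tags, lifting) empty_Collect_eq sum.empty)

lemma finite_permutes_Collect: "finite X \<Longrightarrow> finite {p. p permutes X \<and> P p}"
  by (rule finite_subset[OF _ finite_permutations[of X]]) auto

lemma alt_sum_map:
  assumes "finite X" "q permutes set ys" "set xs \<subseteq> X"
  shows "alt_sum X xs (map q ys) = of_int (sign q) * alt_sum X xs ys"
proof (cases "set ys \<subseteq> X")
  case True
  then have q: "q permutes X" using assms(2) permutes_subset by blast
  then have qp: "permutation q" using assms(1) permutation_permutes by blast
  have "{p. p permutes X \<and> map p xs = map q ys} = (\<lambda>p. q \<circ> p) ` {p. p permutes X \<and> map p xs = ys}"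
  proof (intro equalityI subsetI)
    fix p assume p: "p \<in> {p. p permutes X \<and> map p xs = map q ys}"
    have "p = q \<circ> (inv_into UNIV q \<circ> p)" using permutes_inv_o(1)[OF q] by (simp add: o_assoc)
    moreover have "inv_into UNIV q \<circ> p permutes X" using p q by (auto intro: permutes_compose permutes_inv)
    moreover have "map (inv_into UNIV q \<circ> p) xs = ys"
    proof -
      have "map (inv_into UNIV q \<circ> p) xs = map (inv_into UNIV q) (map p xs)" by simp
      also have "\<dots> = map (inv_into UNIV q \<circ> q) ys" using p by simp
      finally show ?thesis using permutes_inv_o(2)[OF q] by simp
    qed
    ultimately show "p \<in> (\<lambda>p. q \<circ> p) ` {p. p permutes X \<and> map p xs = ys}" by blast
  next
    fix p assume "p \<in> (\<lambda>p. q \<circ> p) ` {p. p permutes X \<and> map p xs = ys}"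
    then show "p \<in> {p. p permutes X \<and> map p xs = map q ys}"
      using q by (auto intro: permutes_compose)
  qed
  moreover have "inj_on (\<lambda>p. q \<circ> p) {p. p permutes X \<and> map p xs = ys}"
    using permutes_inj[OF q] by (auto intro: inj_onI simp: fun.inj_map_strong inj_def fun_eq_iff)
  moreover have "sign (q \<circ> p) = sign q * sign p" if "p permutes X" for p
    using that assms(1) qp permutation_permutes sign_compose by blast
  ultimately show ?thesis
    unfolding alt_sum_def by (simp add: sum.reindex sum_distrib_left)
next
  case False
  \<comment> \<open>A word with a letter outside X is not reached from \<open>xs\<close> by any
    permutation of X, and \<open>map q ys\<close> has the same letters as \<open>ys\<close>, so both
    sides vanish.\<close>
  have "alt_sum X xs zs = 0" if "set zs = set ys" for zs
  proof (rule ccontr)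
    assume "alt_sum X xs zs \<noteq> 0"
    then obtain p where "p permutes X" "map p xs = zs" by (rule alt_sum_nonzeroE)
    then have "set zs \<subseteq> X" using assms(3) by (auto simp: permutes_in_image[OF \<open>p permutes X\<close>] subsetD)
    then show False using False that by blast
  qed
  then show ?thesis using permutes_image[OF assms(2)] by simp
qed

text \<open>Functions are moved by s through the inverse of s on their arguments. Conjugating p by s
  keeps its sign, so the action can be transferred to the set X and the word
  \<open>xs\<close>.\<close>

lemma alt_sum_conjugate:
  assumes "finite U" "s permutes U" "finite X"
  shows "alt_sum X xs (map (inv_into UNIV s) ys) = alt_sum (s ` X) (map s xs) ys"
proof -
  have inj: "inj s" and surj: "surj s" using assms(2) permutes_inj permutes_surj by blast+
  have bij: "bij_betw s X (s ` X)" using inj by (auto simp: bij_betw_def intro: inj_on_subset)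
  have sp: "permutation s" using assms permutation_permutes by blast
  have *: "(s \<circ> p \<circ> inv_into UNIV s) permutes (s ` X)" if "p permutes X" for p
  proof -
    have "map_permutation X s p permutes (s ` X)" by (rule map_permutation_permutes[OF bij that])
    moreover have "map_permutation X s p = s \<circ> p \<circ> inv_into UNIV s"
    proof
      fix y
      obtain x where x: "y = s x" using surj by (metis surjD)
      show "map_permutation X s p y = (s \<circ> p \<circ> inv_into UNIV s) y"
      proof (cases "x \<in> X")
        case True
        then show ?thesis using x inj bij
          by (simp add: map_permutation_apply bij_betw_def inv_f_f)
      next
        case False
        then have "y \<notin> s ` X" using x inj by (auto simp: inj_def)
        then show ?thesis using x inj False that
          by (simp add: map_permutation_def inv_f_f permutes_not_in)
      qed
    qed
    ultimately show ?thesis by simp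
  qed
  have **: "(inv_into UNIV s \<circ> q \<circ> s) permutes X" if "q permutes (s ` X)" for q
  proof (rule bij_imp_permutes)
    have "bij_betw (inv_into UNIV s) (s ` X) X"
      using inj by (auto simp: bij_betw_def inj_on_def image_image)
    then show "bij_betw (inv_into UNIV s \<circ> q \<circ> s) X X"
      using bij permutes_imp_bij[OF that] by (blast intro: bij_betw_trans)
    show "(inv_into UNIV s \<circ> q \<circ> s) x = x" if "x \<notin> X" for x
    proof -
      have "s x \<notin> s ` X" using that inj by (auto simp: inj_def)
      then show ?thesis using \<open>q permutes s ` X\<close> inj by (simp add: permutes_not_in)
    qed
  qed
  have conj: "s \<circ> (inv_into UNIV s \<circ> q \<circ> s) \<circ> inv_into UNIV s = q" "inv_into UNIV s \<circ> (s \<circ> q \<circ> inv_into UNIV s) \<circ> s = q" for q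
    using inj surj by (auto simp: fun_eq_iff surj_f_inv_f)
  have map_eq: "map p xs = map (inv_into UNIV s) ys \<longleftrightarrow> map (s \<circ> p \<circ> inv_into UNIV s) (map s xs) = ys" for p
  proof -
    have "map (s \<circ> p \<circ> inv_into UNIV s) (map s xs) = map s (map p xs)" using inj by simp
    moreover have "map (inv_into UNIV s) (map s zs) = zs" "map s (map (inv_into UNIV s) zs) = zs" for zs
      using inj surj by (simp_all add: surj_f_inv_f o_def)
    ultimately show ?thesis by metis
  qed
  show ?thesis unfolding alt_sum_def
  proof (rule sum.reindex_bij_witness[where i = "\<lambda>q. inv_into UNIV s \<circ> q \<circ> s" and j = "\<lambda>p. s \<circ> p \<circ> inv_into UNIV s"])
    fix p assume p: "p \<in> {p. p permutes X \<and> map p xs = map (inv_into UNIV s) ys}"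
    show "inv_into UNIV s \<circ> (s \<circ> p \<circ> inv_into UNIV s) \<circ> s = p" by (rule conj)
    show "s \<circ> p \<circ> inv_into UNIV s \<in> {p. p permutes s ` X \<and> map p (map s xs) = ys}"
      using p * map_eq by blast
    have "permutation p" using p assms(3) permutation_permutes by blast
    then have "sign (s \<circ> p \<circ> inv_into UNIV s) = sign s * sign p * sign s"
      using sp by (simp add: sign_compose permutation_compose permutation_inverse sign_inverse)
    then show "real_of_int (sign (s \<circ> p \<circ> inv_into UNIV s)) = real_of_int (sign p)"
      by (simp add: sign_def)
  next
    fix q assume q: "q \<in> {q. q permutes s ` X \<and> map q (map s xs) = ys}"
    show "s \<circ> (inv_into UNIV s \<circ> q \<circ> s) \<circ> inv_into UNIV s = q" by (rule conj)
    then show "inv_into UNIV s \<circ> q \<circ> s \<in> {p. p permutes X \<and> map p xs = map (inv_into UNIV s) ys}"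
      using q ** map_eq by auto
  qed
qed

text \<open>The boundary map erases the first letter: summing over b drops the condition on
  \<open>p a\<close>, whose value lies in X and hence in U.\<close>

lemma sum_alt_sum_Cons:
  assumes "finite U" "X \<subseteq> U" "a \<in> X"
  shows "(\<Sum>b\<in>U. alt_sum X (a # xs) (b # ys)) = alt_sum X xs ys"
proof -
  have fin: "finite X" using assms finite_subset by blast
  let ?A = "{p. p permutes X \<and> map p xs = ys}"
  have "alt_sum X xs ys = (\<Sum>b\<in>U. \<Sum>p\<in>{p \<in> ?A. p a = b}. of_int (sign p))"
    unfolding alt_sum_def
    by (subst sum.group) (use assms finite_permutes_Collect[OF fin] in \<open>auto simp: permutes_in_image\<close>)
  also have "\<dots> = (\<Sum>b\<in>U. alt_sum X (a # xs) (b # ys))"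
    unfolding alt_sum_def by (intro sum.cong) auto
  finally show ?thesis by simp
qed

text \<open>Precomposing with the transposition of the two missed elements keeps the image of
  \<open>xs\<close> and reverses the sign. This is the reason why the boundary of a boundary
  vanishes.\<close>

lemma alt_sum_eq_0:
  assumes "finite X" "a \<in> X" "b \<in> X" "a \<noteq> b" "a \<notin> set xs" "b \<notin> set xs"
  shows "alt_sum X xs ys = 0"
proof -
  let ?t = "Transposition.transpose a b"
  have t: "?t permutes X" using assms by (simp add: permutes_swap_id)
  have map_t: "map (p \<circ> ?t) xs = map p xs" for p :: "'a \<Rightarrow> 'a"
    using assms(5,6) by (auto simp: transpose_def)
  have "alt_sum X xs ys = (\<Sum>p | p permutes X \<and> map p xs = ys. - of_int (sign p))"
    unfolding alt_sum_def
  proof (rule sum.reindex_bij_witness[where i = "\<lambda>p. p \<circ> ?t" and j = "\<lambda>p. p \<circ> ?t"])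
    fix p assume p: "p \<in> {p. p permutes X \<and> map p xs = ys}"
    show "p \<circ> ?t \<circ> ?t = p" by (simp add: fun_eq_iff)
    then show "p \<circ> ?t \<circ> ?t = p" .
    show "p \<circ> ?t \<in> {p. p permutes X \<and> map p xs = ys}"
      using p map_t permutes_compose[OF t] by (metis (mono_tags, lifting) mem_Collect_eq)
    then show "p \<circ> ?t \<in> {p. p permutes X \<and> map p xs = ys}" .
    have "permutation p" using p assms(1) permutation_permutes by blast
    then show "- real_of_int (sign (p \<circ> ?t)) = real_of_int (sign p)"
      using assms(4) by (simp add: sign_compose permutation_swap_id sign_swap_id del: o_apply)
  qed
  then show ?thesis unfolding alt_sum_def by (simp add: sum_negf)
qed

text \<open>Only the identity contributes, since a permutation cannot move exactly one point. The
  spare point z covers words that miss one element of X.\<close>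

lemma alt_sum_self:
  assumes "X \<subseteq> insert z (set xs)"
  shows "alt_sum X xs xs = 1"
proof -
  have "p = id" if p: "p permutes X" "map p xs = xs" for p
  proof
    fix x
    have fix': "p y = y" if "y \<noteq> z" for y
    proof (cases "y \<in> set xs")
      case True
      then show ?thesis using p(2) by (metis map_eq_conv map_ident)
    next
      case False
      then have "y \<notin> X" using that assms by blast
      then show ?thesis using p(1) by (rule permutes_not_in[rotated])
    qed
    show "p x = id x"
    proof (cases "x = z")
      case True
      have "p z = z"
      proof (rule ccontr)
        assume "p z \<noteq> z"
        then have "p (p z) = p z" by (rule fix')
        then show False using \<open>p z \<noteq> z\<close> permutes_inj[OF p(1)] by (auto dest: injD)
      qed
      then show ?thesis using True by simp
    qed (use fix' in auto)
  qed
  then have "{p. p permutes X \<and> map p xs = xs} = {id}" by (auto simp: permutes_id)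
  then show ?thesis unfolding alt_sum_def by simp
qed

section \<open>Exterior powers as spaces of alternating functions on words\<close>

lemma ex_permutes_map:
  assumes "distinct xs" "distinct ys" "set xs = set ys"
  obtains q where "q permutes set xs" "map q xs = ys"
proof -
  have len: "length xs = length ys" using assms distinct_card by metis
  define q where "q = (\<lambda>x. if x \<in> set xs then the (map_of (zip xs ys) x) else x)"
  have map_q: "map q xs = ys"
    by (rule nth_equalityI) (use len assms in \<open>auto simp: q_def map_of_zip_nth\<close>)
  then have img: "q ` set xs = set xs" using assms(3) by (metis image_set)
  then have "inj_on q (set xs)" by (simp add: eq_card_imp_inj_on)
  then have "q permutes set xs"
    by (intro bij_imp_permutes) (auto simp: bij_betw_def img, simp add: q_def)
  with map_q show ?thesis using that by blast
qed

text \<open>Model of the r-th exterior power. Rearrangements act through permutations of the letters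
  instead of the positions; on distinct words these are the same rearrangements with the same signs,
  and it matches the permutations in \<open>alt_sum\<close>.\<close>

definition alternating :: "'a set \<Rightarrow> nat \<Rightarrow> ('a list \<Rightarrow> real) set" where
  "alternating U r = {f. (\<forall>ys. f ys \<noteq> 0 \<longrightarrow> distinct ys \<and> length ys = r \<and> set ys \<subseteq> U) \<and>
     (\<forall>ys q. q permutes set ys \<longrightarrow> f (map q ys) = of_int (sign q) * f ys)}"

lemma subspace_alternating: "fun_vs.subspace (alternating U r)"
proof (rule fun_vs.subspaceI)
  fix f g assume f: "f \<in> alternating U r" and g: "g \<in> alternating U r"
  have "distinct ys \<and> length ys = r \<and> set ys \<subseteq> U" if "(f + g) ys \<noteq> 0" for ys
  proof -
    have "f ys \<noteq> 0 \<or> g ys \<noteq> 0" using that by auto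
    then show ?thesis using f g unfolding alternating_def by blast
  qed
  then show "f + g \<in> alternating U r"
    using f g unfolding alternating_def by (simp add: distrib_left)
qed (auto simp: alternating_def)

lemma alternating_zero_cong:
  assumes "f \<in> alternating U r" "f xs = 0" "distinct xs" "set xs = set ys"
  shows "f ys = 0"
proof (cases "distinct ys")
  case True
  obtain q where "q permutes set xs" "map q xs = ys"
    using ex_permutes_map[OF assms(3) True assms(4)] .
  then show ?thesis using assms(1,2) unfolding alternating_def by auto
next
  case False
  then show ?thesis using assms(1) unfolding alternating_def by auto
qed

lemma alt_sum_alternating:
  assumes "finite X" "X \<subseteq> U" "distinct xs" "set xs \<subseteq> X" "length xs = r"
  shows "alt_sum X xs \<in> alternating U r"
proof -
  have "distinct ys \<and> length ys = r \<and> set ys \<subseteq> U" if nz: "alt_sum X xs ys \<noteq> 0" for ys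
  proof -
    obtain p where p: "p permutes X" "map p xs = ys" using nz by (rule alt_sum_nonzeroE)
    have "inj_on p (set xs)" using permutes_inj[OF p(1)] inj_on_subset by blast
    moreover have "set ys \<subseteq> X" using p assms(4) by (auto simp: permutes_in_image[OF p(1)] subsetD)
    ultimately show ?thesis using p assms by (auto simp: distinct_map)
  qed
  then show ?thesis unfolding alternating_def using alt_sum_map assms by blast
qed

abbreviation (input) list_action :: "('a \<Rightarrow> 'a) \<Rightarrow> ('a list \<Rightarrow> real) \<Rightarrow> 'a list \<Rightarrow> real" where
  "list_action s f \<equiv> (\<lambda>ys. f (map (inv_into UNIV s) ys))"

lemma list_action_alternating:
  assumes "finite U" "s permutes U" "f \<in> alternating U r"
  shows "list_action s f \<in> alternating U r"
proof -
  have s': "inv_into UNIV s permutes U" using assms(2) by (rule permutes_inv)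
  have inj: "inj (inv_into UNIV s)" using s' permutes_inj by blast
  have "distinct ys \<and> length ys = r \<and> set ys \<subseteq> U" if "f (map (inv_into UNIV s) ys) \<noteq> 0" for ys
  proof -
    have "distinct (map (inv_into UNIV s) ys) \<and> length (map (inv_into UNIV s) ys) = r \<and> set (map (inv_into UNIV s) ys) \<subseteq> U"
      using that assms(3) unfolding alternating_def by blast
    then show ?thesis using s' by (auto simp: distinct_map permutes_in_image)
  qed
  moreover have "f (map (inv_into UNIV s) (map q ys)) = of_int (sign q) * f (map (inv_into UNIV s) ys)"
    if q: "q permutes set ys" for q ys
  proof -
    have bij: "bij_betw (inv_into UNIV s) (set ys) (set (map (inv_into UNIV s) ys))"
      using inj by (auto simp: bij_betw_def intro: inj_on_subset)
    \<comment> \<open>The inverse of s turns the rearrangement q of \<open>ys\<close> into its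
      conjugate on the image letters, which has the same sign.\<close>
    let ?q = "map_permutation (set ys) (inv_into UNIV s) q"
    have "?q permutes set (map (inv_into UNIV s) ys)"
      by (rule map_permutation_permutes[OF bij q])
    moreover have "sign ?q = sign q"
      by (rule sign_map_permutation) (use q bij in \<open>auto simp: bij_betw_def\<close>)
    moreover have "map (inv_into UNIV s) (map q ys) = map ?q (map (inv_into UNIV s) ys)"
      using bij by (auto simp: map_permutation_apply bij_betw_def)
    moreover have "f (map ?q (map (inv_into UNIV s) ys))
        = of_int (sign ?q) * f (map (inv_into UNIV s) ys)"
      using assms(3) calculation(1) unfolding alternating_def by blast
    ultimately show ?thesis by metis
  qed
  ultimately show ?thesis unfolding alternating_def by blast
qed

lemma lin_on_eval: "lin_on V (\<lambda>f. f y)" "lin_on V (\<lambda>f. \<Sum>b\<in>U. f (g b))"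
  unfolding lin_on_def by (auto simp: sum.distrib sum_distrib_left)

abbreviation (input) srt :: "nat set \<Rightarrow> nat list" where "srt \<equiv> sorted_list_of_set"

text \<open>The difference between f and its expansion is killed by all functionals, because they
  are dual to the vectors; since the functionals separate the points of V, it is 0.\<close>

lemma reproducingI:
  assumes V: "fun_vs.subspace V" and fin: "finite I" and e: "\<And>i. i \<in> I \<Longrightarrow> e i \<in> V"
    and lin: "\<And>i. i \<in> I \<Longrightarrow> lin_on V (p i)"
    and dual: "\<And>i j. i \<in> I \<Longrightarrow> j \<in> I \<Longrightarrow> p i (e j) = (if i = j then 1 else 0)"
    and zero: "\<And>f. f \<in> V \<Longrightarrow> (\<And>i. i \<in> I \<Longrightarrow> p i f = 0) \<Longrightarrow> f = 0"
  shows "reproducing V I e p"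
proof -
  have "f = (\<Sum>i\<in>I. scale_fun (p i f) (e i))" if f: "f \<in> V" for f
  proof -
    let ?g = "\<Sum>i\<in>I. scale_fun (p i f) (e i)"
    have g: "?g \<in> V" using V e by (intro fun_vs.subspace_sum fun_vs.subspace_scale) auto
    have d: "f - ?g \<in> V" using V f g by (rule fun_vs.subspace_diff)
    have "p i (f - ?g) = 0" if i: "i \<in> I" for i
    proof -
      have "p i ((f - ?g) + ?g) = p i (f - ?g) + p i ?g"
        using lin[OF i] d g unfolding lin_on_def by blast
      then have "p i f = p i (f - ?g) + p i ?g" unfolding diff_add_cancel .
      moreover have "p i ?g = (\<Sum>j\<in>I. p j f * p i (e j))"
        by (rule lin_on_sum[OF lin[OF i] V e])
      moreover have "(\<Sum>j\<in>I. p j f * p i (e j)) = p i f"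
      proof -
        have "(\<Sum>j\<in>I. p j f * p i (e j)) = (\<Sum>j\<in>I. if i = j then p j f else 0)"
          using dual[OF i] by (intro sum.cong) auto
        then show ?thesis using fin i by simp
      qed
      ultimately show ?thesis by linarith
    qed
    then have "f - ?g = 0" by (rule zero[OF d])
    then show ?thesis by (rule right_minus_eq[THEN iffD1])
  qed
  then show ?thesis unfolding reproducing_def using fin e lin by blast
qed

lemma alternating_eq_0I:
  assumes "finite U" "f \<in> alternating U r" "\<And>A. A \<subseteq> U \<Longrightarrow> card A = r \<Longrightarrow> f (srt A) = 0"
  shows "f = 0"
proof
  fix ys
  show "f ys = 0 ys"
  proof (cases "distinct ys \<and> length ys = r \<and> set ys \<subseteq> U")
    case True
    then have "f (srt (set ys)) = 0" using assms(3)[of "set ys"] distinct_card by fastforce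
    then show ?thesis using alternating_zero_cong[OF assms(2), of "srt (set ys)" ys] by simp
  next
    case False
    then show ?thesis using assms(2) unfolding alternating_def zero_fun_def by blast
  qed
qed

text \<open>The values of an alternating function on lists containing the base point \<open>0\<close> are recovered
  from its boundary and its values on the other lists.\<close>

lemma alternating_eq_0I_boundary:
  assumes U: "finite U" "0 \<in> U" and f: "f \<in> alternating U r"
    and no0: "\<And>A. A \<subseteq> U - {0} \<Longrightarrow> card A = r \<Longrightarrow> f (srt A) = 0"
    and bd: "\<And>A. A \<subseteq> U - {0} \<Longrightarrow> Suc (card A) = r \<Longrightarrow> (\<Sum>b\<in>U. f (b # srt A)) = 0"
  shows "f = 0"
proof (rule alternating_eq_0I[OF U(1) f])
  fix B assume B: "B \<subseteq> U" "card B = r"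
  have finB: "finite B" using B U(1) finite_subset by blast
  show "f (srt B) = 0"
  proof (cases "0 \<in> B")
    case False
    then show ?thesis using no0 B by (metis Diff_empty subset_Diff_insert)
  next
    case True
    define A where "A = B - {0}"
    have A: "A \<subseteq> U - {0}" "Suc (card A) = r" "finite A"
      using B True finB card_Suc_Diff1[OF finB True] unfolding A_def by auto
    \<comment> \<open>In the boundary at A only b = 0 survives: any other b either repeats a letter
      of A or yields a set without 0. So the boundary condition gives the value on
      \<open>0 # srt A\<close>.\<close>
    have "f (b # srt A) = 0" if b: "b \<in> U" "b \<noteq> 0" for b
    proof (cases "b \<in> A")
      case True
      then have "\<not> distinct (b # srt A)" using A(3) by simp
      then show ?thesis using f unfolding alternating_def by blast
    next
      case False
      then have "f (srt (insert b A)) = 0" using A b by (intro no0) auto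
      then show ?thesis
        by (rule alternating_zero_cong[OF f]) (use A(3) in \<open>auto simp del: sorted_list_of_set_insert_remove\<close>)
    qed
    then have "(\<Sum>b\<in>U. f (b # srt A)) = f (0 # srt A)"
      using U by (subst sum.remove[of _ 0]) auto
    then have "f (0 # srt A) = 0" using bd[OF A(1,2)] by simp
    then show ?thesis
      by (rule alternating_zero_cong[OF f]) (use A(3) True finB in \<open>auto simp: A_def\<close>)
  qed
qed

section \<open>Wedge products, and boundaries of cones with apex 0\<close>

abbreviation (input) chain :: "nat set \<Rightarrow> nat list \<Rightarrow> real" where
  "chain A \<equiv> alt_sum A (srt A)"

abbreviation (input) bdry :: "nat set \<Rightarrow> nat list \<Rightarrow> real" where
  "bdry A \<equiv> alt_sum (insert 0 A) (srt A)"

lemma chain_dual: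
  assumes "finite A" "finite B"
  shows "chain A (srt B) = (if B = A then 1 else 0)"
proof (cases "B = A")
  case True
  \<comment> \<open>A wedge product misses no letter of A, so the spare point may be
    anything.\<close>
  then show ?thesis using assms by (simp add: alt_sum_self[of _ undefined] subset_insertI)
next
  case False
  have "chain A (srt B) = 0"
  proof (rule ccontr)
    assume "chain A (srt B) \<noteq> 0"
    then obtain p where p: "p permutes A" "map p (srt A) = srt B" by (rule alt_sum_nonzeroE)
    have "set (map p (srt A)) = p ` A" using assms(1) by simp
    then have "p ` A = B" unfolding p(2) using assms(2) by simp
    then show False using False permutes_image[OF p(1)] by simp
  qed
  then show ?thesis using False by simp
qed

text \<open>The boundary of the cone over A contains A with coefficient 1, and all its other terms
  contain the apex 0; words without 0 see only the former.\<close>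

lemma bdry_dual:
  assumes "finite A" "finite B" "0 \<notin> A" "0 \<notin> B" "card A = card B"
  shows "bdry A (srt B) = (if B = A then 1 else 0)"
proof (cases "B = A")
  case True
  then show ?thesis using assms by (simp add: alt_sum_self[of _ 0])
next
  case False
  have "bdry A (srt B) = 0"
  proof (rule ccontr)
    assume "bdry A (srt B) \<noteq> 0"
    then obtain p where p: "p permutes (insert 0 A)" "map p (srt A) = srt B" by (rule alt_sum_nonzeroE)
    have "set (map p (srt A)) = p ` A" using assms(1) by simp
    then have "p ` A = B" unfolding p(2) using assms(2) by simp
    moreover have "p ` A \<subseteq> p ` insert 0 A" by (rule image_mono) (rule subset_insertI)
    ultimately have "B \<subseteq> insert 0 A" unfolding permutes_image[OF p(1)] by simp
    then have "B \<subseteq> A" using assms(4) by blast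
    then show False using False assms by (simp add: card_subset_eq)
  qed
  then show ?thesis using False by simp
qed

text \<open>Erasing the head a of \<open>xs\<close> leaves a word that misses both z and a, where
  \<open>alt_sum_eq_0\<close> applies.\<close>

lemma alt_sum_boundary:
  assumes "finite U" "X \<subseteq> U" "set xs \<subseteq> X" "distinct xs" "z \<in> X" "z \<notin> set xs"
  shows "(\<Sum>b\<in>U. alt_sum X xs (b # ys)) = 0"
proof (cases xs)
  case Nil
  \<comment> \<open>Degree zero: the empty word has no image of the form \<open>b # ys\<close>, so
    every summand is an empty sum.\<close>
  then show ?thesis by (simp add: alt_sum_def)
next
  case (Cons a as)
  have "(\<Sum>b\<in>U. alt_sum X xs (b # ys)) = alt_sum X as ys"
    unfolding Cons by (rule sum_alt_sum_Cons) (use assms Cons in auto)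
  also have "\<dots> = 0"
    by (rule alt_sum_eq_0[of _ z a]) (use assms Cons finite_subset[OF assms(2,1)] in auto)
  finally show ?thesis .
qed

lemma bdry_bdry:
  assumes "finite U" "insert 0 A \<subseteq> U" "0 \<notin> A"
  shows "(\<Sum>b\<in>U. bdry A (b # ys)) = 0"
proof -
  have "finite A" by (rule finite_subset[OF _ assms(1)]) (use assms(2) in auto)
  then show ?thesis using assms by (intro alt_sum_boundary[of _ _ _ 0]) auto
qed

section \<open>Exactness of the complex and the traces on its cycles\<close>

context
  fixes U :: "nat set"
  assumes U: "finite U" "0 \<in> U"
begin

lemma reproducing_chain:
  "reproducing (alternating U r) {A. A \<subseteq> U \<and> card A = r} chain (\<lambda>A f. f (srt A))"
proof (rule reproducingI[OF subspace_alternating])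
  have fin: "finite A" if "A \<subseteq> U" for A using that U(1) finite_subset by blast
  show "finite {A. A \<subseteq> U \<and> card A = r}" using U(1) by simp
  show "chain A \<in> alternating U r" if "A \<in> {A. A \<subseteq> U \<and> card A = r}" for A
    using that fin[of A] by (intro alt_sum_alternating) auto
  show "chain A (srt B) = (if B = A then 1 else 0)"
    if "B \<in> {A. A \<subseteq> U \<and> card A = r}" "A \<in> {A. A \<subseteq> U \<and> card A = r}" for A B
    using that fin by (intro chain_dual) auto
  show "f = 0" if "f \<in> alternating U r" "\<And>A. A \<in> {A. A \<subseteq> U \<and> card A = r} \<Longrightarrow> f (srt A) = 0" for f
    using that by (intro alternating_eq_0I[OF U(1)]) auto
qed (rule lin_on_eval(1))

abbreviation (input) sub0 :: "nat \<Rightarrow> nat set set" where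
  "sub0 r \<equiv> {A. A \<subseteq> U - {0} \<and> card A = r}"

lemma sub0D:
  assumes "A \<in> sub0 r"
  shows "finite A" "0 \<notin> A" "A \<subseteq> U" "card A = r" "insert 0 A \<subseteq> U"
proof -
  show "A \<subseteq> U" "0 \<notin> A" "card A = r" using assms by auto
  then show "insert 0 A \<subseteq> U" "finite A" using U by (simp_all add: finite_subset)
qed

lemma bdry_alternating:
  assumes "A \<in> sub0 r"
  shows "bdry A \<in> alternating U r"
  using sub0D[OF assms] by (intro alt_sum_alternating) auto

text \<open>The kernel of the boundary map. In degree 0 the condition holds automatically, since f
  vanishes on nonempty words; the complex is not augmented and its degree-0 cycles are the trivial
  module.\<close>

definition alternating_cycles :: "nat \<Rightarrow> (nat list \<Rightarrow> real) set" where
  "alternating_cycles r = {f \<in> alternating U r. \<forall>ys. (\<Sum>b\<in>U. f (b # ys)) = 0}"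

lemma subspace_alternating_cycles: "fun_vs.subspace (alternating_cycles r)"
proof (rule fun_vs.subspaceI)
  fix f g assume "f \<in> alternating_cycles r" "g \<in> alternating_cycles r"
  moreover from this have "f + g \<in> alternating U r"
    unfolding alternating_cycles_def by (intro fun_vs.subspace_add[OF subspace_alternating]) auto
  ultimately show "f + g \<in> alternating_cycles r"
    unfolding alternating_cycles_def by (simp add: sum.distrib)
next
  fix c f assume f: "f \<in> alternating_cycles r"
  have "scale_fun c f \<in> alternating U r"
    using f fun_vs.subspace_scale[OF subspace_alternating, of f U r c]
    unfolding alternating_cycles_def by blast
  with f show "scale_fun c f \<in> alternating_cycles r"
    unfolding alternating_cycles_def by (simp add: sum_distrib_left[symmetric])
next
  show "0 \<in> alternating_cycles r"
    using fun_vs.subspace_0[OF subspace_alternating, of U r] by (simp add: alternating_cycles_def)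
qed

text \<open>This is the exactness: a cycle is determined by its values on sets without 0, hence it
  is a combination of boundaries of cones.\<close>

lemma reproducing_bdry:
  "reproducing (alternating_cycles r) (sub0 r) bdry (\<lambda>A f. f (srt A))"
proof (rule reproducingI[OF subspace_alternating_cycles])
  show "finite (sub0 r)" using U(1) by simp
  show "bdry A \<in> alternating_cycles r" if A: "A \<in> sub0 r" for A
    using bdry_alternating[OF A] bdry_bdry[OF U(1), of A] sub0D[OF A]
    unfolding alternating_cycles_def by blast
  show "bdry A (srt B) = (if B = A then 1 else 0)" if "B \<in> sub0 r" "A \<in> sub0 r" for A B
    using sub0D[OF that(1)] sub0D[OF that(2)] by (intro bdry_dual) auto
  show "f = 0" if "f \<in> alternating_cycles r" "\<And>A. A \<in> sub0 r \<Longrightarrow> f (srt A) = 0" for f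
    using that by (intro alternating_eq_0I_boundary[OF U]) (auto simp: alternating_cycles_def)
qed (rule lin_on_eval(1))

text \<open>This exhibits the \<open>Suc r\<close>-th exterior power as an extension of the \<open>r\<close>-boundaries by the
  \<open>Suc r\<close>-cycles.\<close>

lemma reproducing_split:
  "reproducing (alternating U (Suc r)) (sub0 (Suc r) <+> sub0 r)
     (case_sum bdry (\<lambda>A. alt_sum (insert 0 A) (0 # srt A)))
     (case_sum (\<lambda>A f. f (srt A)) (\<lambda>A f. \<Sum>b\<in>U. f (b # srt A)))"
proof (rule reproducingI[OF subspace_alternating])
  let ?I = "sub0 (Suc r) <+> sub0 r"
  let ?e = "case_sum bdry (\<lambda>A. alt_sum (insert 0 A) (0 # srt A))"
  let ?p = "case_sum (\<lambda>A f. f (srt A)) (\<lambda>A f. \<Sum>b\<in>U. f (b # srt A)) :: _ \<Rightarrow> (nat list \<Rightarrow> real) \<Rightarrow> real"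
  show "finite ?I" using U(1) by simp
  show "?e i \<in> alternating U (Suc r)" if "i \<in> ?I" for i
    using that
  proof
    fix A assume A: "i = Inl A" "A \<in> sub0 (Suc r)"
    then show ?thesis using bdry_alternating[OF A(2)] by simp
  next
    fix A assume A: "i = Inr A" "A \<in> sub0 r"
    have "alt_sum (insert 0 A) (0 # srt A) \<in> alternating U (Suc r)"
      using sub0D[OF A(2)] U by (intro alt_sum_alternating) auto
    then show ?thesis using A by simp
  qed
  show "lin_on (alternating U (Suc r)) (?p i)" if "i \<in> ?I" for i
    using that by (auto intro: lin_on_eval)
  show "?p i (?e j) = (if i = j then 1 else 0)" if i: "i \<in> ?I" and j: "j \<in> ?I" for i j
    using i
  proof
    fix B assume B: "i = Inl B" "B \<in> sub0 (Suc r)"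
    show ?thesis using j
    proof
      fix A assume A: "j = Inl A" "A \<in> sub0 (Suc r)"
      show ?thesis using A B sub0D[OF A(2)] sub0D[OF B(2)] by (simp add: bdry_dual)
    next
      fix A assume A: "j = Inr A" "A \<in> sub0 r"
      \<comment> \<open>Every word in the wedge product of \<open>0 # srt A\<close> contains 0, and
        B does not.\<close>
      have "alt_sum (insert 0 A) (0 # srt A) (srt B) = 0"
      proof (rule ccontr)
        assume "alt_sum (insert 0 A) (0 # srt A) (srt B) \<noteq> 0"
        then obtain p where p: "p permutes (insert 0 A)" "map p (0 # srt A) = srt B"
          by (rule alt_sum_nonzeroE)
        have "set (map p (0 # srt A)) = p ` insert 0 A" using sub0D[OF A(2)] by simp
        then have "B = insert 0 A"
          unfolding p(2) permutes_image[OF p(1)] using sub0D(1)[OF B(2)] by simp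
        then show False using sub0D(2)[OF B(2)] by simp
      qed
      then show ?thesis using A B by simp
    qed
  next
    fix B assume B: "i = Inr B" "B \<in> sub0 r"
    show ?thesis using j
    proof
      fix A assume A: "j = Inl A" "A \<in> sub0 (Suc r)"
      show ?thesis using A B sub0D[OF A(2)] bdry_bdry[OF U(1)] by simp
    next
      fix A assume A: "j = Inr A" "A \<in> sub0 r"
      \<comment> \<open>The boundary of the cone over A is \<open>bdry A\<close>, so the functionals
        of the second kind reduce to the duality of the boundaries one degree lower.\<close>
      have "(\<Sum>b\<in>U. alt_sum (insert 0 A) (0 # srt A) (b # srt B)) = bdry A (srt B)"
        by (rule sum_alt_sum_Cons[OF U(1)]) (use sub0D[OF A(2)] in auto)
      then show ?thesis using A B sub0D[OF A(2)] sub0D[OF B(2)] by (simp add: bdry_dual)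
    qed
  qed
  show "f = 0" if f: "f \<in> alternating U (Suc r)" and z: "\<And>i. i \<in> ?I \<Longrightarrow> ?p i f = 0" for f
  proof (rule alternating_eq_0I_boundary[OF U f])
    fix A assume "A \<subseteq> U - {0}" "card A = Suc r"
    then show "f (srt A) = 0" using z[of "Inl A"] by auto
  next
    fix A assume "A \<subseteq> U - {0}" "Suc (card A) = Suc r"
    then show "(\<Sum>b\<in>U. f (b # srt A)) = 0" using z[of "Inr A"] by auto
  qed
qed

text \<open>The trace of s on \<open>alternating_cycles r\<close>, read off in the system of
  \<open>reproducing_bdry\<close>, with the action already transferred to the set and the word by
  \<open>alt_sum_conjugate\<close>.\<close>

definition cycle_trace :: "(nat \<Rightarrow> nat) \<Rightarrow> nat \<Rightarrow> real" where
  "cycle_trace s r = (\<Sum>A\<in>sub0 r. alt_sum (s ` insert 0 A) (map s (srt A)) (srt A))"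

text \<open>A diagonal coefficient of s on the exterior power. It vanishes unless A is invariant;
  then s may be replaced by its restriction to A, and conjugating back inside A leaves the sign of
  that restriction.\<close>

lemma chain_action:
  assumes s: "s permutes U" and A: "A \<subseteq> U"
  shows "alt_sum (s ` A) (map s (srt A)) (srt A)
    = (if s ` A = A then of_int (sign (perm_restrict s A)) else 0)"
proof (cases "s ` A = A")
  case True
  have fin: "finite A" using A U(1) finite_subset by blast
  have r: "perm_restrict s A permutes A" by (rule perm_restrict_permutes[OF s True])
  have pr: "permutation (perm_restrict s A)" using r fin permutation_permutes by blast
  have m: "map s (srt A) = map (perm_restrict s A) (srt A)"
    using fin by (auto simp: perm_restrict_def)
  have *: "perm_restrict s A ` A = A" using permutes_image[OF r] .
  have "alt_sum (s ` A) (map s (srt A)) (srt A)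
      = alt_sum (perm_restrict s A ` A) (map (perm_restrict s A) (srt A)) (srt A)"
    unfolding m True * ..
  also have "\<dots> = alt_sum A (srt A) (map (inv_into UNIV (perm_restrict s A)) (srt A))"
    by (rule alt_sum_conjugate[symmetric, OF fin r fin])
  also have "\<dots> = of_int (sign (inv_into UNIV (perm_restrict s A))) * alt_sum A (srt A) (srt A)"
    using fin r by (intro alt_sum_map) (auto intro: permutes_inv)
  also have "\<dots> = of_int (sign (perm_restrict s A))"
    using sign_inverse[OF pr] chain_dual[OF fin fin] by simp
  finally show ?thesis using True by simp
next
  case False
  have fin: "finite A" using A U(1) finite_subset by blast
  have "alt_sum (s ` A) (map s (srt A)) (srt A) = 0"
  proof (rule ccontr)
    assume "alt_sum (s ` A) (map s (srt A)) (srt A) \<noteq> 0"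
    then obtain p where p: "p permutes s ` A" "map p (map s (srt A)) = srt A"
      by (rule alt_sum_nonzeroE)
    have "set (map p (map s (srt A))) = p ` (s ` A)" using fin by auto
    then have "A = s ` A" unfolding p(2) permutes_image[OF p(1)] using fin by simp
    then show False using False by simp
  qed
  then show ?thesis using False by simp
qed

text \<open>The trace of s on the exterior power of degree \<open>Suc r\<close> is computed twice.
  Wedge products give the signed count of invariant sets; the split system gives the traces on the
  cycles of degree \<open>Suc r\<close> and, through the boundary, of degree r.\<close>

lemma cycle_trace_Suc:
  assumes s: "s permutes U"
  shows "cycle_trace s (Suc r) + cycle_trace s r
    = (\<Sum>A | A \<subseteq> U \<and> s ` A = A \<and> card A = Suc r. of_int (sign (perm_restrict s A)))"
proof -
  have act: "alt_sum X xs (map (inv_into UNIV s) ys) = alt_sum (s ` X) (map s xs) ys" if "X \<subseteq> U" for X xs ys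
    using alt_sum_conjugate[OF U(1) s] that U(1) finite_subset by blast
  have "(\<Sum>A | A \<subseteq> U \<and> card A = Suc r. alt_sum A (srt A) (map (inv_into UNIV s) (srt A)))
    = (\<Sum>i\<in>sub0 (Suc r) <+> sub0 r. case_sum (\<lambda>A f. f (srt A)) (\<lambda>A f. \<Sum>b\<in>U. f (b # srt A)) i
        (list_action s (case_sum bdry (\<lambda>A. alt_sum (insert 0 A) (0 # srt A)) i)))"
    by (rule reproducing_trace_eq[OF subspace_alternating list_action_alternating[OF U(1) s] _
          reproducing_chain reproducing_split]) (auto intro: lin_on_eval)
  also have "\<dots> = (\<Sum>A\<in>sub0 (Suc r). bdry A (map (inv_into UNIV s) (srt A)))
      + (\<Sum>A\<in>sub0 r. \<Sum>b\<in>U. alt_sum (insert 0 A) (0 # srt A) (map (inv_into UNIV s) (b # srt A)))"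
    using U(1) by (subst sum.Plus) (auto simp: o_def)
  also have "(\<Sum>A\<in>sub0 (Suc r). bdry A (map (inv_into UNIV s) (srt A))) = cycle_trace s (Suc r)"
    unfolding cycle_trace_def
  proof (rule sum.cong[OF refl])
    fix A assume "A \<in> sub0 (Suc r)"
    then show "bdry A (map (inv_into UNIV s) (srt A))
        = alt_sum (s ` insert 0 A) (map s (srt A)) (srt A)"
      by (intro act sub0D(5))
  qed
  also have "(\<Sum>A\<in>sub0 r. \<Sum>b\<in>U. alt_sum (insert 0 A) (0 # srt A) (map (inv_into UNIV s) (b # srt A)))
      = cycle_trace s r"
    unfolding cycle_trace_def
  proof (rule sum.cong[OF refl])
    fix A assume A: "A \<in> sub0 r"
    have "(\<Sum>b\<in>U. alt_sum (insert 0 A) (0 # srt A) (map (inv_into UNIV s) (b # srt A)))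
      = (\<Sum>b\<in>U. alt_sum (s ` insert 0 A) (s 0 # map s (srt A)) (b # srt A))"
      unfolding act[OF sub0D(5)[OF A]] by simp
    \<comment> \<open>The boundary erases the image \<open>s 0\<close> of the apex, so it commutes
      with s.\<close>
    also have "\<dots> = alt_sum (s ` insert 0 A) (map s (srt A)) (srt A)"
      by (rule sum_alt_sum_Cons[OF U(1)]) (use sub0D[OF A] U in \<open>auto simp: permutes_in_image[OF s]\<close>)
    finally show "(\<Sum>b\<in>U. alt_sum (insert 0 A) (0 # srt A) (map (inv_into UNIV s) (b # srt A)))
      = alt_sum (s ` insert 0 A) (map s (srt A)) (srt A)" .
  qed
  also have "(\<Sum>A | A \<subseteq> U \<and> card A = Suc r. alt_sum A (srt A) (map (inv_into UNIV s) (srt A)))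
      = (\<Sum>A | A \<subseteq> U \<and> card A = Suc r. if s ` A = A then of_int (sign (perm_restrict s A)) else 0)"
    by (rule sum.cong[OF refl]) (simp add: act chain_action[OF s])
  also have "\<dots> = (\<Sum>A | A \<subseteq> U \<and> s ` A = A \<and> card A = Suc r. of_int (sign (perm_restrict s A)))"
    using U(1) by (subst sum.If_cases) (auto intro!: sum.cong)
  finally show ?thesis by simp
qed

text \<open>The recursion is solved down to degree 0. The alternating sign with exponent
  \<open>r - card A\<close> is the expansion of 1 / (1 + q).\<close>

lemma cycle_trace_eq:
  assumes s: "s permutes U"
  shows "cycle_trace s r
    = (\<Sum>A | A \<subseteq> U \<and> s ` A = A \<and> card A \<le> r. (-1) ^ (r - card A) * of_int (sign (perm_restrict s A)))"
proof (induction r)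
  case 0
  have "sub0 0 = {{}}" using U(1) finite_subset by (auto simp: card_eq_0_iff)
  then have "cycle_trace s 0 = alt_sum {s 0} [] []" unfolding cycle_trace_def by simp
  also have "\<dots> = 1" by (rule alt_sum_self) auto
  finally have 1: "cycle_trace s 0 = 1" .
  have "{A. A \<subseteq> U \<and> s ` A = A \<and> card A \<le> 0} = {{}}"
    using U(1) finite_subset by (auto simp: card_eq_0_iff)
  moreover have "perm_restrict s {} = id" by (auto simp: perm_restrict_def)
  ultimately show ?case using 1 by simp
next
  case (Suc r)
  let ?g = "\<lambda>r A. (-1) ^ (r - card A) * real_of_int (sign (perm_restrict s A))"
  let ?I = "\<lambda>P. {A. A \<subseteq> U \<and> s ` A = A \<and> P (card A)}"
  have "(\<Sum>A\<in>?I (\<lambda>c. c \<le> Suc r). ?g (Suc r) A)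
    = (\<Sum>A\<in>?I (\<lambda>c. c \<le> r) \<union> ?I (\<lambda>c. c = Suc r). ?g (Suc r) A)"
    by (rule sum.cong) auto
  also have "\<dots> = (\<Sum>A\<in>?I (\<lambda>c. c \<le> r). ?g (Suc r) A) + (\<Sum>A\<in>?I (\<lambda>c. c = Suc r). ?g (Suc r) A)"
    by (rule sum.union_disjoint) (use U(1) in auto)
  also have "(\<Sum>A\<in>?I (\<lambda>c. c \<le> r). ?g (Suc r) A) = - (\<Sum>A\<in>?I (\<lambda>c. c \<le> r). ?g r A)"
    unfolding sum_negf[symmetric] by (rule sum.cong) (auto simp: Suc_diff_le)
  also have "\<dots> = - cycle_trace s r" using Suc by simp
  also have "(\<Sum>A\<in>?I (\<lambda>c. c = Suc r). ?g (Suc r) A) = cycle_trace s (Suc r) + cycle_trace s r"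
    unfolding cycle_trace_Suc[OF s] by (rule sum.cong) auto
  finally show ?case by simp
qed

end

lemma hook_char_eq_cycle_trace:
  assumes U: "finite U" "0 \<in> U" and s: "s permutes U" and j: "j \<le> card U"
  shows "hook_char U s (int j) = cycle_trace U s (card U - j)"
  unfolding hook_char_def cycle_trace_eq[OF U s]
proof (rule sum.cong)
  have c: "card (U - A) = card U - card A \<and> card A \<le> card U" if "A \<subseteq> U" for A
    using that U(1) by (simp add: card_Diff_subset card_mono finite_subset)
  show "{A. A \<subseteq> U \<and> s ` A = A \<and> int j \<le> int (card (U - A))}
    = {A. A \<subseteq> U \<and> s ` A = A \<and> card A \<le> card U - j}"
    using c j by fastforce
  fix A assume "A \<in> {A. A \<subseteq> U \<and> s ` A = A \<and> card A \<le> card U - j}"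
  then have A: "A \<subseteq> U" by blast
  have "nat (int (card (U - A)) - int j) = card U - j - card A"
    using c[OF A] j by linarith
  then show "(-1) ^ nat (int (card (U - A)) - int j) * real_of_int (sign (perm_restrict s A))
    = (-1) ^ (card U - j - card A) * of_int (sign (perm_restrict s A))" by simp
qed

section \<open>Specht modules of hooks\<close>

text \<open>Below the first row all rows are singletons, and the first row is the complement. So
  functions on hook tabloids are functions on words, where the exterior powers live.\<close>

definition hook_tabloid :: "nat set \<Rightarrow> nat list \<Rightarrow> nat set list" where
  "hook_tabloid U xs = (U - set xs) # map (\<lambda>x. {x}) xs"

lemma hook_tabloid_eq_iff: "hook_tabloid U xs = hook_tabloid U ys \<longleftrightarrow> xs = ys"
proof
  assume "hook_tabloid U xs = hook_tabloid U ys"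
  then have "map (\<lambda>x. {x}) xs = map (\<lambda>x. {x}) ys" unfolding hook_tabloid_def by simp
  moreover have "inj (\<lambda>x::nat. {x})" by (auto intro: injI)
  ultimately show "xs = ys" by (metis inj_map_eq_map)
qed simp

lemma map_image_hook_tabloid:
  assumes "s permutes U"
  shows "map ((`) s) (hook_tabloid U xs) = hook_tabloid U (map s xs)"
  using permutes_image[OF assms] image_set_diff[OF permutes_inj[OF assms], of U "set xs"]
  unfolding hook_tabloid_def by simp

text \<open>Extension by 0, since elements of the Specht module are functions on all lists of
  sets.\<close>

definition lift_tabloid :: "nat set \<Rightarrow> (nat list \<Rightarrow> real) \<Rightarrow> nat set list \<Rightarrow> real" where
  "lift_tabloid U f X = (if \<exists>xs. X = hook_tabloid U xs then f (THE xs. X = hook_tabloid U xs) else 0)"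

lemma lift_tabloid_apply [simp]: "lift_tabloid U f (hook_tabloid U xs) = f xs"
  unfolding lift_tabloid_def by (auto simp: hook_tabloid_eq_iff)

lemma lift_tabloid_outside: "\<nexists>xs. X = hook_tabloid U xs \<Longrightarrow> lift_tabloid U f X = 0"
  unfolding lift_tabloid_def by simp

lemma lift_tabloid_eqI:
  assumes "\<And>xs. F (hook_tabloid U xs) = f xs" "\<And>X. \<nexists>xs. X = hook_tabloid U xs \<Longrightarrow> F X = 0"
  shows "F = lift_tabloid U f"
  by (rule ext) (metis assms lift_tabloid_apply lift_tabloid_outside)

lemma perm_act_lift_tabloid:
  assumes "s permutes U"
  shows "perm_act s (lift_tabloid U f) = lift_tabloid U (list_action s f)"
proof (rule lift_tabloid_eqI)
  show "perm_act s (lift_tabloid U f) (hook_tabloid U xs) = f (map (inv_into UNIV s) xs)" for xs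
    unfolding perm_act_def map_image_hook_tabloid[OF permutes_inv[OF assms]] by simp
next
  fix X assume X: "\<nexists>xs. X = hook_tabloid U xs"
  have "\<nexists>xs. map ((`) (inv_into UNIV s)) X = hook_tabloid U xs"
  proof
    assume "\<exists>xs. map ((`) (inv_into UNIV s)) X = hook_tabloid U xs"
    then obtain xs where xs: "map ((`) (inv_into UNIV s)) X = hook_tabloid U xs" ..
    have "map ((`) s) (map ((`) (inv_into UNIV s)) X) = X"
      using permutes_surj[OF assms] by (simp add: o_def image_image surj_f_inv_f)
    then have "X = hook_tabloid U (map s xs)"
      unfolding xs map_image_hook_tabloid[OF assms] by simp
    then show False using X by blast
  qed
  then show "perm_act s (lift_tabloid U f) X = 0"
    unfolding perm_act_def by (rule lift_tabloid_outside)
qed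

section \<open>Polytabloids of a fixed hook shape, and the character\<close>

context
  fixes j m :: nat
  assumes j: "1 \<le> j" "j \<le> m"
begin

abbreviation (input) leg :: "(nat \<times> nat \<Rightarrow> nat) \<Rightarrow> nat list" where
  "leg t \<equiv> map (\<lambda>i. t (Suc i, 0)) [0..<m - j]"

lemma sum_list_hook: "sum_list (hook j m) = m"
  using j by (simp add: hook_def sum_list_replicate)

lemma cells_hook: "cells (hook j m) = (\<lambda>i. (i, 0)) ` {0..m - j} \<union> (\<lambda>c. (0, c)) ` {1..<j}"
proof -
  have "(i, c) \<in> cells (hook j m) \<longleftrightarrow> i \<le> m - j \<and> (if i = 0 then c < j else c = 0)" for i c
    unfolding cells_def hook_def by (cases i) auto
  then show ?thesis using j by (auto simp: image_iff split: if_splits)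
qed

lemma tableau_hook_leg:
  assumes "is_tableau (hook j m) t"
  shows "inj_on t (cells (hook j m))" "t ` cells (hook j m) = {0..<m}"
    "distinct (leg t)" "set (leg t) \<subseteq> {0..<m}" "t (0, 0) \<in> {0..<m}" "t (0, 0) \<notin> set (leg t)" "length (leg t) = m - j"
proof -
  show inj: "inj_on t (cells (hook j m))" and img: "t ` cells (hook j m) = {0..<m}"
    using assms unfolding is_tableau_def sum_list_hook by (auto simp: bij_betw_def)
  have c: "(i, 0) \<in> cells (hook j m)" if "i \<le> m - j" for i using that unfolding cells_hook by auto
  show "distinct (leg t)"
    unfolding distinct_map
  proof
    show "inj_on (\<lambda>i. t (Suc i, 0)) (set [0..<m - j])"
    proof (rule inj_onI)
      fix x y assume "x \<in> set [0..<m - j]" "y \<in> set [0..<m - j]" "t (Suc x, 0) = t (Suc y, 0)"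
      then show "x = y" using inj_onD[OF inj _ c c, of "Suc x" "Suc y"] by auto
    qed
  qed simp
  show "set (leg t) \<subseteq> {0..<m}" "t (0, 0) \<in> {0..<m}" using img c by auto
  show "t (0, 0) \<notin> set (leg t)"
  proof
    assume "t (0, 0) \<in> set (leg t)"
    then obtain i where "i < m - j" "t (0, 0) = t (Suc i, 0)" by auto
    then show False using inj_onD[OF inj _ c c, of 0 "Suc i"] by simp
  qed
  show "length (leg t) = m - j" by simp
qed

lemma tabloid_hook:
  assumes "is_tableau (hook j m) t"
  shows "tabloid (hook j m) t = hook_tabloid {0..<m} (leg t)"
proof -
  note t = tableau_hook_leg[OF assms]
  have len: "length (hook j m) = Suc (m - j)" by (simp add: hook_def)
  have "{t (0, c) |c. c < hook j m ! 0} = t ` ((\<lambda>c. (0, c)) ` {0..<j})"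
    by (auto simp: hook_def)
  also have "(\<lambda>c. (0, c)) ` {0..<j} = cells (hook j m) - (\<lambda>i. (i, 0)) ` {1..m - j}"
    unfolding cells_hook using j by (auto simp: image_iff)
  also have "t ` \<dots> = {0..<m} - t ` (\<lambda>i. (i, 0)) ` {1..m - j}"
    using t(2) by (subst inj_on_image_set_diff[OF t(1)]) (auto simp: cells_hook)
  also have "t ` (\<lambda>i. (i, 0)) ` {1..m - j} = set (leg t)"
  proof -
    have "{1..m - j} = Suc ` {0..<m - j}" by (simp add: atLeastLessThanSuc_atLeastAtMost)
    then show ?thesis by (simp only: image_image set_map set_upt)
  qed
  finally have 1: "{t (0, c) |c. c < hook j m ! 0} = {0..<m} - set (leg t)" .
  have 2: "{t (i, c) |c. c < hook j m ! i} = {t (i, 0)}" if "i \<in> Suc ` {0..<m - j}" for i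
    using that by (auto simp: hook_def)
  have "tabloid (hook j m) t
    = {t (0, c) |c. c < hook j m ! 0} # map (\<lambda>i. {t (i, c) |c. c < hook j m ! i}) (map Suc [0..<m - j])"
    unfolding tabloid_def len map_Suc_upt by (subst upt_conv_Cons) simp_all
  also have "map (\<lambda>i. {t (i, c) |c. c < hook j m ! i}) (map Suc [0..<m - j]) = map (\<lambda>x. {x}) (leg t)"
    unfolding map_map by (rule map_cong[OF refl]) (simp add: 2)
  finally show ?thesis unfolding hook_tabloid_def 1 .
qed

text \<open>All columns but the first consist of one cell, which forces the entries of the arm to be
  fixed; the first column may be permuted freely.\<close>

lemma column_stabilizer_hook:
  assumes "is_tableau (hook j m) t"
  shows "column_stabilizer (hook j m) t = {p. p permutes insert (t (0, 0)) (set (leg t))}"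
proof -
  note t = tableau_hook_leg[OF assms]
  let ?X = "insert (t (0, 0)) (set (leg t))"
  have X: "?X = t ` (\<lambda>i. (i, 0)) ` {0..m - j}"
  proof -
    have "{0..m - j} = insert 0 (Suc ` {0..<m - j})"
      by (auto simp: atLeastLessThanSuc_atLeastAtMost)
    then show ?thesis by (simp only: image_image image_insert set_map set_upt)
  qed
  have XV: "?X \<subseteq> {0..<m}" using t(4,5) by blast
  show ?thesis
  proof (intro equalityI subsetI)
    fix p assume "p \<in> column_stabilizer (hook j m) t"
    then have p: "p permutes {0..<m}"
      "\<And>r c. (r, c) \<in> cells (hook j m) \<Longrightarrow> \<exists>r'. (r', c) \<in> cells (hook j m) \<and> p (t (r, c)) = t (r', c)"
      unfolding column_stabilizer_def sum_list_hook by auto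
    have "p x = x" if x: "x \<in> {0..<m} - ?X" for x
    proof -
      obtain c where c: "1 \<le> c" "c < j" "x = t (0, c)"
      proof -
        have "x \<in> t ` cells (hook j m)" using x t(2) by blast
        then have "x \<in> t ` (\<lambda>c. (0, c)) ` {1..<j}" using x unfolding X cells_hook by blast
        then show ?thesis using that by auto
      qed
      have "(0, c) \<in> cells (hook j m)" unfolding cells_hook using c by auto
      then obtain r' where r': "(r', c) \<in> cells (hook j m)" "p (t (0, c)) = t (r', c)" using p(2) by blast
      then have "r' = 0" using c(1) unfolding cells_hook by auto
      then show ?thesis using r' c by simp
    qed
    then show "p \<in> {p. p permutes ?X}" using p(1) permutes_superset by blast
  next
    fix p assume "p \<in> {p. p permutes ?X}"
    then have p: "p permutes ?X" by simp
    have "\<exists>r'. (r', c) \<in> cells (hook j m) \<and> p (t (r, c)) = t (r', c)"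
      if rc: "(r, c) \<in> cells (hook j m)" for r c
    proof (cases "c = 0")
      case True
      then have "r \<le> m - j" using rc unfolding cells_hook by auto
      then have "t (r, 0) \<in> ?X" unfolding X by auto
      then have "p (t (r, 0)) \<in> ?X" using permutes_in_image[OF p] by blast
      then show ?thesis unfolding X True cells_hook by auto
    next
      case False
      then have "r = 0" using rc unfolding cells_hook by auto
      have "t (0, c) \<notin> ?X"
      proof
        assume "t (0, c) \<in> ?X"
        then obtain i where i: "i \<le> m - j" "t (0, c) = t (i, 0)" unfolding X by auto
        then show False
          using inj_onD[OF t(1), of "(0, c)" "(i, 0)"] rc \<open>r = 0\<close> False unfolding cells_hook by auto
      qed
      then show ?thesis using rc permutes_not_in[OF p] \<open>r = 0\<close> by auto
    qed
    then show "p \<in> column_stabilizer (hook j m) t"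
      unfolding column_stabilizer_def sum_list_hook using permutes_subset[OF p XV] by auto
  qed
qed

lemma is_tableau_comp:
  assumes "is_tableau (hook j m) t" "p permutes {0..<m}"
  shows "is_tableau (hook j m) (p \<circ> t)"
  using bij_betw_trans[OF assms(1)[unfolded is_tableau_def sum_list_hook] permutes_imp_bij[OF assms(2)]]
  unfolding is_tableau_def sum_list_hook .

text \<open>The sum runs over permutations of the whole first column, but the tabloid records only
  the images of the leg. The result is the boundary of the wedge product of the column.\<close>

lemma polytabloid_hook:
  assumes "is_tableau (hook j m) t"
  shows "polytabloid (hook j m) t
    = lift_tabloid {0..<m} (alt_sum (insert (t (0, 0)) (set (leg t))) (leg t))"
proof -
  note t = tableau_hook_leg[OF assms]
  let ?X = "insert (t (0, 0)) (set (leg t))"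
  have fin: "finite {p. p permutes ?X}" by (rule finite_permutations) simp
  have tab: "tabloid (hook j m) (p \<circ> t) = hook_tabloid {0..<m} (map p (leg t))" if "p permutes ?X" for p
  proof -
    have "p permutes {0..<m}" using that by (rule permutes_subset) (use t(4,5) in blast)
    then show ?thesis using tabloid_hook[OF is_tableau_comp[OF assms]] by (simp add: o_def)
  qed
  have eq: "polytabloid (hook j m) t Y
      = (\<Sum>p | p permutes ?X. if Y = hook_tabloid {0..<m} (map p (leg t)) then of_int (sign p) else 0)" for Y
    unfolding polytabloid_def column_stabilizer_hook[OF assms]
    by (rule sum.cong) (simp_all add: tab)
  show ?thesis
  proof (rule lift_tabloid_eqI)
    fix xs
    have "(\<Sum>p | p permutes ?X. if xs = map p (leg t) then real_of_int (sign p) else 0)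
      = alt_sum ?X (leg t) xs"
      unfolding alt_sum_def using fin
      by (subst sum.inter_filter[symmetric]) (auto intro!: sum.cong)
    then show "polytabloid (hook j m) t (hook_tabloid {0..<m} xs) = alt_sum ?X (leg t) xs"
      unfolding eq hook_tabloid_eq_iff .
  next
    fix Y assume "\<nexists>xs. Y = hook_tabloid {0..<m} xs"
    then show "polytabloid (hook j m) t Y = 0" unfolding eq by (intro sum.neutral) auto
  qed
qed

text \<open>The arm can be filled by any bijection g. With corner 0 and sorted leg A this realizes
  the lift of \<open>bdry A\<close> as a polytabloid.\<close>

lemma ex_tableau_hook:
  assumes xs: "distinct xs" "set xs \<subseteq> {0..<m}" "length xs = m - j" and z: "z \<in> {0..<m}" "z \<notin> set xs"
  obtains t where "is_tableau (hook j m) t" "t (0, 0) = z" "leg t = xs"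
proof -
  let ?as = "z # xs"
  have "card ({0..<m} - set ?as) = m - Suc (m - j)"
    using xs z distinct_card[of ?as] by (subst card_Diff_subset) auto
  then have "card {1..<j} = card ({0..<m} - set ?as)" using j by auto
  then obtain g where g: "bij_betw g {1..<j} ({0..<m} - set ?as)"
    using finite_same_card_bij[of "{1..<j}" "{0..<m} - set ?as"] by auto
  define t where "t = (\<lambda>(i, c). if c = 0 then ?as ! i else g c)"
  have 1: "bij_betw t ((\<lambda>i. (i, 0)) ` {0..m - j}) (set ?as)"
  proof -
    have "bij_betw (\<lambda>i. ?as ! i) {..<length ?as} (set ?as)"
      by (rule bij_betw_nth) (use xs z in auto)
    moreover have "{..<length ?as} = {0..m - j}" using xs(3) by auto
    ultimately have "bij_betw (t \<circ> (\<lambda>i. (i, 0))) {0..m - j} (set ?as)"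
      unfolding t_def by (simp add: o_def)
    then show ?thesis by (auto simp: bij_betw_def inj_on_def image_image o_def)
  qed
  have 2: "bij_betw t ((\<lambda>c. (0, c)) ` {1..<j}) ({0..<m} - set ?as)"
  proof -
    have "bij_betw (t \<circ> (\<lambda>c. (0, c))) {1..<j} ({0..<m} - set ?as)"
      using g by (subst bij_betw_cong[of _ _ g]) (auto simp: t_def)
    then show ?thesis by (auto simp: bij_betw_def inj_on_def image_image o_def)
  qed
  have "bij_betw t (cells (hook j m)) (set ?as \<union> ({0..<m} - set ?as))"
    unfolding cells_hook by (rule bij_betw_combine[OF 1 2]) blast
  moreover have "set ?as \<union> ({0..<m} - set ?as) = {0..<m}" using xs z by auto
  ultimately have "is_tableau (hook j m) t" unfolding is_tableau_def sum_list_hook by simp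
  moreover have "t (0, 0) = z" by (simp add: t_def)
  moreover have "leg t = xs"
    by (rule nth_equalityI) (use xs(3) in \<open>auto simp: t_def\<close>)
  ultimately show ?thesis using that by blast
qed

lemma zero_in_range: "0 \<in> {0..<m}" "finite {0..<m}" using j by auto

text \<open>Generators suffice: polytabloids are lifts of boundaries, hence of cycles, and the lifts
  of cycles form a subspace.\<close>

lemma specht_hook_lift:
  assumes "F \<in> specht_module (hook j m)"
  obtains f where "f \<in> alternating_cycles {0..<m} (m - j)" "F = lift_tabloid {0..<m} f"
proof -
  let ?L = "lift_tabloid {0..<m} ` alternating_cycles {0..<m} (m - j)"
  note sub = subspace_alternating_cycles[OF zero_in_range(2,1), of "m - j"]
  have "specht_module (hook j m) \<subseteq> ?L"
    unfolding specht_module_def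
  proof (rule fun_vs.span_minimal)
    show "{polytabloid (hook j m) t |t. is_tableau (hook j m) t} \<subseteq> ?L"
    proof
      fix F assume "F \<in> {polytabloid (hook j m) t |t. is_tableau (hook j m) t}"
      then obtain t where F: "F = polytabloid (hook j m) t" "is_tableau (hook j m) t" by blast
      note t = tableau_hook_leg[OF F(2)]
      let ?X = "insert (t (0, 0)) (set (leg t))"
      have XV: "?X \<subseteq> {0..<m}" using t(4,5) by blast
      have "alt_sum ?X (leg t) \<in> alternating {0..<m} (m - j)"
        by (rule alt_sum_alternating[OF _ XV t(3) _ t(7)]) auto
      moreover have "(\<Sum>b\<in>{0..<m}. alt_sum ?X (leg t) (b # ys)) = 0" for ys
        by (rule alt_sum_boundary[OF zero_in_range(2) XV _ t(3) _ t(6)]) auto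
      ultimately have "alt_sum ?X (leg t) \<in> alternating_cycles {0..<m} (m - j)"
        unfolding alternating_cycles_def[OF zero_in_range(2,1)] by blast
      then show "F \<in> ?L" unfolding F(1) polytabloid_hook[OF F(2)] by blast
    qed
    have add: "lift_tabloid {0..<m} f + lift_tabloid {0..<m} g = lift_tabloid {0..<m} (f + g)" for f g
      by (rule lift_tabloid_eqI) (auto simp: lift_tabloid_outside)
    have scale: "scale_fun c (lift_tabloid {0..<m} f) = lift_tabloid {0..<m} (scale_fun c f)" for c f
      by (rule lift_tabloid_eqI) (auto simp: lift_tabloid_outside)
    have zero: "0 = lift_tabloid {0..<m} 0" by (rule lift_tabloid_eqI) auto
    show "fun_vs.subspace ?L"
    proof (rule fun_vs.subspaceI)
      show "0 \<in> ?L" using fun_vs.subspace_0[OF sub] zero by blast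
      show "F + F' \<in> ?L" if FF: "F \<in> ?L" "F' \<in> ?L" for F F'
      proof -
        obtain f g where "f \<in> alternating_cycles {0..<m} (m - j)" "g \<in> alternating_cycles {0..<m} (m - j)"
          "F = lift_tabloid {0..<m} f" "F' = lift_tabloid {0..<m} g" using FF by blast
        then show ?thesis using add[of f g] fun_vs.subspace_add[OF sub, of f g] by (metis image_eqI)
      qed
      show "scale_fun c F \<in> ?L" if FF: "F \<in> ?L" for c F
      proof -
        obtain f where "f \<in> alternating_cycles {0..<m} (m - j)" "F = lift_tabloid {0..<m} f" using FF by blast
        then show ?thesis using scale[of c f] fun_vs.subspace_scale[OF sub, of f c] by (metis image_eqI)
      qed
    qed
  qed
  then show ?thesis using assms that by blast
qed

text \<open>The lifts of \<open>bdry A\<close> lie in the Specht module as polytabloids, and they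
  reproduce it because all its elements are lifts of cycles. The trace is therefore the one on
  cycles.\<close>

lemma irr_char_hook_cycle_trace:
  assumes s: "s permutes {0..<m}"
  shows "irr_char (hook j m) s = cycle_trace {0..<m} s (m - j)"
proof -
  let ?S = "specht_module (hook j m)"
  let ?I = "{A. A \<subseteq> {0..<m} - {0} \<and> card A = m - j}"
  note U = zero_in_range(2,1)
  have sub: "fun_vs.subspace ?S" unfolding specht_module_def by (rule fun_vs.subspace_span)
  have gen: "polytabloid (hook j m) t \<in> ?S" if "is_tableau (hook j m) t" for t
    unfolding specht_module_def using that by (intro fun_vs.span_base) blast
  have act_gen: "perm_act s (polytabloid (hook j m) t) = polytabloid (hook j m) (s \<circ> t)"
    if t: "is_tableau (hook j m) t" for t
  proof -
    have "list_action s (alt_sum X xs) = alt_sum (s ` X) (map s xs)" if "finite X" for X xs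
      using alt_sum_conjugate[OF U(1) s that] by auto
    then show ?thesis
      unfolding polytabloid_hook[OF t] polytabloid_hook[OF is_tableau_comp[OF t s]]
        perm_act_lift_tabloid[OF s] by (simp add: image_image o_def)
  qed
  have inv: "perm_act s F \<in> ?S" if "F \<in> ?S" for F
  proof -
    \<comment> \<open>Invariance needs checking on generators only, where s sends the polytabloid of
      t to that of \<open>s \<circ> t\<close>.\<close>
    have "fun_vs.subspace {F. perm_act s F \<in> ?S}"
    proof (rule fun_vs.subspaceI)
      have "perm_act s 0 = 0" by (auto simp: perm_act_def)
      then show "0 \<in> {F. perm_act s F \<in> ?S}" using fun_vs.subspace_0[OF sub] by simp
      have add: "perm_act s (F + F') = perm_act s F + perm_act s F'" for F F'
        by (auto simp: perm_act_def)
      show "F + F' \<in> {F. perm_act s F \<in> ?S}"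
        if "F \<in> {F. perm_act s F \<in> ?S}" "F' \<in> {F. perm_act s F \<in> ?S}" for F F'
        using that fun_vs.subspace_add[OF sub, of "perm_act s F" "perm_act s F'"] add[of F F'] by simp
      have scale: "perm_act s (scale_fun c F) = scale_fun c (perm_act s F)" for c F
        by (auto simp: perm_act_def)
      show "scale_fun c F \<in> {F. perm_act s F \<in> ?S}" if "F \<in> {F. perm_act s F \<in> ?S}" for c F
        using that fun_vs.subspace_scale[OF sub, of "perm_act s F" c] scale[of c F] by simp
    qed
    moreover have "{polytabloid (hook j m) t |t. is_tableau (hook j m) t} \<subseteq> {F. perm_act s F \<in> ?S}"
      using act_gen gen is_tableau_comp[OF _ s] by auto
    ultimately have "?S \<subseteq> {F. perm_act s F \<in> ?S}"
      using fun_vs.span_minimal unfolding specht_module_def by blast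
    then show ?thesis using that by blast
  qed
  have "reproducing ?S ?I (\<lambda>A. lift_tabloid {0..<m} (alt_sum (insert 0 A) (sorted_list_of_set A)))
      (\<lambda>A F. F (hook_tabloid {0..<m} (sorted_list_of_set A)))"
    unfolding reproducing_def
  proof (intro conjI ballI)
    show "finite ?I" by simp
    show "lin_on ?S (\<lambda>F. F (hook_tabloid {0..<m} (sorted_list_of_set A)))" for A by (rule lin_on_eval(1))
    show "lift_tabloid {0..<m} (alt_sum (insert 0 A) (sorted_list_of_set A)) \<in> ?S" if A: "A \<in> ?I" for A
    proof -
      note A' = sub0D[OF U A]
      obtain t where t: "is_tableau (hook j m) t" "t (0, 0) = 0" "leg t = sorted_list_of_set A"
        by (rule ex_tableau_hook[of "sorted_list_of_set A" 0]) (use A' U in auto)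
      show ?thesis using gen[OF t(1)] A'(1) unfolding polytabloid_hook[OF t(1)] t(2,3) by simp
    qed
    show "F = (\<Sum>A\<in>?I. scale_fun (F (hook_tabloid {0..<m} (sorted_list_of_set A)))
        (lift_tabloid {0..<m} (alt_sum (insert 0 A) (sorted_list_of_set A))))" if F: "F \<in> ?S" for F
    proof -
      obtain f where f: "f \<in> alternating_cycles {0..<m} (m - j)" "F = lift_tabloid {0..<m} f"
        using specht_hook_lift[OF F] .
      have "f = (\<Sum>A\<in>?I. scale_fun (f (sorted_list_of_set A)) (alt_sum (insert 0 A) (sorted_list_of_set A)))"
        using reproducing_bdry[OF U, of "m - j"] f(1) unfolding reproducing_def by blast
      then have f_xs: "f xs = (\<Sum>A\<in>?I. f (sorted_list_of_set A) * alt_sum (insert 0 A) (sorted_list_of_set A) xs)" for xs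
        by (metis (no_types, lifting) sum_fun_apply sum.cong)
      have "(\<Sum>A\<in>?I. scale_fun (F (hook_tabloid {0..<m} (sorted_list_of_set A)))
        (lift_tabloid {0..<m} (alt_sum (insert 0 A) (sorted_list_of_set A)))) = lift_tabloid {0..<m} f"
      proof (rule lift_tabloid_eqI)
        show "(\<Sum>A\<in>?I. scale_fun (F (hook_tabloid {0..<m} (sorted_list_of_set A)))
          (lift_tabloid {0..<m} (alt_sum (insert 0 A) (sorted_list_of_set A)))) (hook_tabloid {0..<m} xs) = f xs" for xs
          unfolding sum_fun_apply f(2) lift_tabloid_apply by (rule f_xs[symmetric])
      qed (simp add: sum_fun_apply lift_tabloid_outside)
      then show ?thesis using f(2) by simp
    qed
  qed
  moreover have "lin_on ?S (\<lambda>F. perm_act s F X)" for X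
    unfolding perm_act_def by (rule lin_on_eval(1))
  ultimately have "trace_on ?S (perm_act s) = (\<Sum>A\<in>?I. perm_act s
      (lift_tabloid {0..<m} (alt_sum (insert 0 A) (sorted_list_of_set A))) (hook_tabloid {0..<m} (sorted_list_of_set A)))"
    by (intro trace_on_reproducing[OF sub inv]) auto
  also have "\<dots> = cycle_trace {0..<m} s (m - j)"
    unfolding cycle_trace_def[OF U]
  proof (rule sum.cong[OF refl])
    fix A assume "A \<in> ?I"
    then have "finite (insert 0 A)" using sub0D(1)[OF U] by blast
    then show "perm_act s (lift_tabloid {0..<m} (alt_sum (insert 0 A) (sorted_list_of_set A)))
        (hook_tabloid {0..<m} (sorted_list_of_set A))
      = alt_sum (s ` insert 0 A) (map s (sorted_list_of_set A)) (sorted_list_of_set A)"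
      unfolding perm_act_lift_tabloid[OF s] lift_tabloid_apply
      by (rule alt_sum_conjugate[OF U(1) s])
  qed
  finally show ?thesis unfolding irr_char_def .
qed

lemma irr_char_hook:
  assumes "s permutes {0..<m}"
  shows "irr_char (hook j m) s = hook_char {0..<m} s (int j)"
  using irr_char_hook_cycle_trace[OF assms] hook_char_eq_cycle_trace[OF zero_in_range(2,1) assms, of j] j
  by simp

end

section \<open>Expansion of hook immanants\<close>

text \<open>Indexed by an arbitrary set, so that a principal submatrix is a restriction to a subset
  and the recursion involves no renumbering of rows.\<close>

definition hook_imm :: "'a set \<Rightarrow> int \<Rightarrow> ('a \<Rightarrow> 'a \<Rightarrow> real) \<Rightarrow> real" where
  "hook_imm S k h = (\<Sum>s | s permutes S. hook_char S s k * (\<Prod>i\<in>S. h i (s i)))"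

lemma hook_char_relabel:
  assumes f: "bij_betw f S S'" and s: "s permutes S" and fin: "finite S"
  shows "hook_char S' (map_permutation S f s) k = hook_char S s k"
proof -
  let ?s = "map_permutation S f s"
  have inj: "inj_on f S" and img: "f ` S = S'" using f by (auto simp: bij_betw_def)
  have s_in: "s ` A \<subseteq> S" if "A \<subseteq> S" for A using that permutes_image[OF s] by blast
  have app: "?s ` f ` A = f ` s ` A" if "A \<subseteq> S" for A
    using that inj by (auto simp: map_permutation_apply image_iff subset_iff)
  have inv: "?s ` f ` A = f ` A \<longleftrightarrow> s ` A = A" if "A \<subseteq> S" for A
    unfolding app[OF that] using inj_on_image_eq_iff[OF inj s_in[OF that] that] .
  have card: "card (S' - f ` A) = card (S - A)" if "A \<subseteq> S" for A
  proof -
    have "S' - f ` A = f ` (S - A)" using inj that img by (simp add: inj_on_image_set_diff)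
    then show ?thesis using inj card_image inj_on_subset by (metis Diff_subset)
  qed
  have sgn: "sign (perm_restrict ?s (f ` A)) = sign (perm_restrict s A)" if A: "A \<subseteq> S" "s ` A = A" for A
  proof -
    have r: "perm_restrict s A permutes S"
      using perm_restrict_permutes[OF s A(2)] A(1) permutes_subset by blast
    have "perm_restrict ?s (f ` A) = map_permutation S f (perm_restrict s A)"
    proof
      fix y
      show "perm_restrict ?s (f ` A) y = map_permutation S f (perm_restrict s A) y"
      proof (cases "y \<in> S'")
        case True
        then obtain x where x: "x \<in> S" "y = f x" using img by blast
        have "f x \<in> f ` A \<longleftrightarrow> x \<in> A" using inj x(1) A(1) by (auto dest: inj_onD)
        then show ?thesis using x inj by (auto simp: perm_restrict_def map_permutation_apply)
      next
        case False
        then have "y \<notin> f ` A" using A(1) img by blast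
        then show ?thesis using False img by (simp add: perm_restrict_def map_permutation_def)
      qed
    qed
    then show ?thesis using sign_map_permutation[OF inj r fin] by simp
  qed
  have "{B. B \<subseteq> S' \<and> ?s ` B = B \<and> k \<le> int (card (S' - B))}
      = (`) f ` {A. A \<subseteq> S \<and> s ` A = A \<and> k \<le> int (card (S - A))}" (is "?L = _ ` ?R")
  proof (intro equalityI subsetI)
    fix B assume B: "B \<in> ?L"
    then obtain A where A: "A \<subseteq> S" "B = f ` A" using img by (auto simp: subset_image_iff)
    then show "B \<in> (`) f ` ?R" using B inv[OF A(1)] card[OF A(1)] by auto
  next
    fix B assume "B \<in> (`) f ` ?R"
    then obtain A where A: "A \<in> ?R" "B = f ` A" by blast
    then have AS: "A \<subseteq> S" by blast
    then show "B \<in> ?L" using A inv[OF AS] card[OF AS] img by auto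
  qed
  moreover have "inj_on ((`) f) ?R"
    using inj by (auto simp: inj_on_def inj_on_image_eq_iff[OF inj])
  ultimately show ?thesis
    unfolding hook_char_def by (simp add: sum.reindex) (rule sum.cong[OF refl], simp add: card sgn)
qed

lemma hook_imm_relabel:
  assumes f: "bij_betw f S S'" and fin: "finite S"
  shows "hook_imm S' k h = hook_imm S k (\<lambda>i j. h (f i) (f j))"
proof -
  have inj: "inj_on f S" and img: "f ` S = S'" using f by (auto simp: bij_betw_def)
  have f': "bij_betw (inv_into S f) S' S" by (rule bij_betw_inv_into[OF f])
  show ?thesis unfolding hook_imm_def
  proof (rule sym, rule sum.reindex_bij_witness[where i = "map_permutation S' (inv_into S f)"
        and j = "map_permutation S f"])
    fix s assume "s \<in> {s. s permutes S}"
    then have s: "s permutes S" by simp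
    show "map_permutation S' (inv_into S f) (map_permutation S f s) = s"
      by (rule map_permutation_compose_inv[OF f s]) (simp add: inj)
    show "map_permutation S f s \<in> {s. s permutes S'}"
      using map_permutation_permutes[OF f s] by simp
    have "(\<Prod>i\<in>S'. h i (map_permutation S f s i)) = (\<Prod>i\<in>S. h (f i) (f (s i)))"
      unfolding img[symmetric] prod.reindex[OF inj] using inj
      by (auto intro!: prod.cong simp: map_permutation_apply)
    then show "hook_char S' (map_permutation S f s) k * (\<Prod>i\<in>S'. h i (map_permutation S f s i))
      = hook_char S s k * (\<Prod>i\<in>S. h (f i) (f (s i)))"
      using hook_char_relabel[OF f s fin] by simp
  next
    fix s assume "s \<in> {s. s permutes S'}"
    then have s: "s permutes S'" by simp
    show "map_permutation S f (map_permutation S' (inv_into S f) s) = s"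
      by (rule map_permutation_compose_inv[OF f' s]) (use img in \<open>auto simp: f_inv_into_f\<close>)
    show "map_permutation S' (inv_into S f) s \<in> {s. s permutes S}"
      using map_permutation_permutes[OF f' s] by simp
  qed
qed

lemma hook_imm_cong:
  assumes "\<And>i j. i \<in> S \<Longrightarrow> j \<in> S \<Longrightarrow> h i j = h' i j"
  shows "hook_imm S k h = hook_imm S k h'"
  unfolding hook_imm_def
proof (rule sum.cong[OF refl])
  fix s assume "s \<in> {s. s permutes S}"
  then have "(\<Prod>i\<in>S. h i (s i)) = (\<Prod>i\<in>S. h' i (s i))"
    by (intro prod.cong) (auto simp: assms permutes_in_image)
  then show "hook_char S s k * (\<Prod>i\<in>S. h i (s i)) = hook_char S s k * (\<Prod>i\<in>S. h' i (s i))" by simp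
qed

section \<open>Grouping permutations by their cycle through a point\<close>

definition cycles_through :: "'a set \<Rightarrow> 'a \<Rightarrow> ('a set \<times> ('a \<Rightarrow> 'a)) set" where
  "cycles_through S v = {(C, c). C \<subseteq> S \<and> v \<in> C \<and> c permutes C \<and> orbit c v = C}"

lemma finite_cycles_through:
  assumes "finite S"
  shows "finite (cycles_through S v)"
proof -
  have "cycles_through S v \<subseteq> Sigma (Pow S) (\<lambda>C. {c. c permutes C})"
    unfolding cycles_through_def by auto
  moreover have "finite (Sigma (Pow S) (\<lambda>C. {c. c permutes C}))"
    using assms by (intro finite_SigmaI) (auto intro: finite_permutations finite_subset)
  ultimately show ?thesis by (rule finite_subset)
qed

lemma hook_imm_expand:
  assumes fin: "finite S" and v: "v \<in> S"
  shows "hook_imm S k h = (\<Sum>(C, c)\<in>cycles_through S v. (\<Prod>i\<in>C. h i (c i)) *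
    (hook_imm (S - C) (k - int (card C)) h - (-1) ^ card C * hook_imm (S - C) k h))"
proof -
  let ?F = "\<lambda>s. hook_char S s k * (\<Prod>i\<in>S. h i (s i))"
  let ?P = "\<lambda>C. {t. t permutes (S - C)}"
  have inner: "(\<Sum>t\<in>?P C. ?F (c \<circ> t)) = (\<Prod>i\<in>C. h i (c i)) *
    (hook_imm (S - C) (k - int (card C)) h - (-1) ^ card C * hook_imm (S - C) k h)"
    if "(C, c) \<in> cycles_through S v" for C c
  proof -
    have C: "C \<subseteq> S" "c permutes C" "cyclic_on c C"
      using that unfolding cycles_through_def cyclic_on_def by auto
    have finC: "finite C" using C(1) fin finite_subset by blast
    have "?F (c \<circ> t) = (\<Prod>i\<in>C. h i (c i)) *
        (hook_char (S - C) t (k - int (card C)) * (\<Prod>i\<in>S - C. h i (t i))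
          - (-1) ^ card C * (hook_char (S - C) t k * (\<Prod>i\<in>S - C. h i (t i))))"
      if t: "t permutes (S - C)" for t
    proof -
      have "(\<Prod>i\<in>S. h i ((c \<circ> t) i)) = (\<Prod>i\<in>S - C. h i ((c \<circ> t) i)) * (\<Prod>i\<in>C. h i ((c \<circ> t) i))"
        by (rule prod.subset_diff[OF C(1) fin])
      also have "(\<Prod>i\<in>C. h i ((c \<circ> t) i)) = (\<Prod>i\<in>C. h i (c i))"
        by (rule prod.cong) (use permutes_not_in[OF t] in auto)
      also have "(\<Prod>i\<in>S - C. h i ((c \<circ> t) i)) = (\<Prod>i\<in>S - C. h i (t i))"
      proof (rule prod.cong[OF refl])
        fix i assume "i \<in> S - C"
        then have "t i \<notin> C" using permutes_in_image[OF t, of i] by blast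
        then show "h i ((c \<circ> t) i) = h i (t i)" using permutes_not_in[OF C(2)] by simp
      qed
      finally show ?thesis
        unfolding hook_char_cycle[OF fin C t] by (simp add: algebra_simps)
    qed
    then have "(\<Sum>t\<in>?P C. ?F (c \<circ> t)) = (\<Sum>t\<in>?P C. (\<Prod>i\<in>C. h i (c i)) *
        (hook_char (S - C) t (k - int (card C)) * (\<Prod>i\<in>S - C. h i (t i))
          - (-1) ^ card C * (hook_char (S - C) t k * (\<Prod>i\<in>S - C. h i (t i)))))"
      by (intro sum.cong) auto
    then show ?thesis
      unfolding hook_imm_def by (simp add: sum_distrib_left sum_subtractf right_diff_distrib)
  qed
  \<comment> \<open>A cycle (C, c) through v and a permutation t of the rest correspond to
    \<open>c \<circ> t\<close>; the inverse map takes the orbit of v and the two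
    restrictions.\<close>
  have "hook_imm S k h
      = (\<Sum>(x, t)\<in>Sigma (cycles_through S v) (\<lambda>x. ?P (fst x)). ?F (snd x \<circ> t))"
    unfolding hook_imm_def
  proof (rule sum.reindex_bij_witness[where i = "\<lambda>y. snd (fst y) \<circ> snd y"
        and j = "\<lambda>s. ((orbit s v, perm_restrict s (orbit s v)), perm_restrict s (S - orbit s v))"])
    fix s assume "s \<in> {s. s permutes S}"
    then have "s permutes S" by simp
    note d = orbit_decompose[OF fin this v]
    let ?y = "((orbit s v, perm_restrict s (orbit s v)), perm_restrict s (S - orbit s v))"
    show "snd (fst ?y) \<circ> snd ?y = s" unfolding fst_conv snd_conv by (rule d(6))
    show "?y \<in> Sigma (cycles_through S v) (\<lambda>x. ?P (fst x))"
      unfolding cycles_through_def using d(1-5) by simp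
    show "(case ?y of (x, t) \<Rightarrow> ?F (snd x \<circ> t)) = ?F s"
      unfolding prod.case fst_conv snd_conv d(6) ..
  next
    fix x assume "x \<in> Sigma (cycles_through S v) (\<lambda>x. ?P (fst x))"
    then obtain C c t where x: "x = ((C, c), t)" "(C, c) \<in> cycles_through S v" "t permutes (S - C)"
      by auto
    have C: "C \<subseteq> S" "v \<in> C" "c permutes C" "orbit c v = C"
      using x(2) unfolding cycles_through_def by auto
    have ct: "(c \<circ> t) i = c i" if "i \<in> C" for i using permutes_not_in[OF x(3)] that by simp
    have ct': "(c \<circ> t) i = t i" if "i \<notin> C" for i
    proof -
      have "t i \<notin> C"
        using that permutes_in_image[OF x(3), of i] permutes_not_in[OF x(3), of i] by (cases "i \<in> S - C") auto
      then show ?thesis using permutes_not_in[OF C(3)] by simp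
    qed
    \<comment> \<open>\<open>c \<circ> t\<close> agrees with c on C, and c maps C to itself, so the
      orbit of v does not notice t.\<close>
    have orb: "orbit (c \<circ> t) v = C"
    proof -
      have "orbit c v = orbit (c \<circ> t) v"
        by (rule orbit_cong0[OF C(2)]) (use permutes_in_image[OF C(3)] ct in auto)
      then show ?thesis using C(4) by simp
    qed
    have r1: "perm_restrict (c \<circ> t) C = c"
      by (rule ext) (metis ct perm_restrict_def permutes_not_in[OF C(3)])
    have r2: "perm_restrict (c \<circ> t) (S - C) = t"
      by (rule ext) (metis ct' perm_restrict_def permutes_not_in[OF x(3)] DiffD2)
    let ?s = "snd (fst x) \<circ> snd x"
    have s: "?s = c \<circ> t" unfolding x(1) fst_conv snd_conv ..
    show "((orbit ?s v, perm_restrict ?s (orbit ?s v)), perm_restrict ?s (S - orbit ?s v)) = x"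
      unfolding x(1) fst_conv snd_conv orb r1 r2 ..
    have "c permutes S" "t permutes S" using permutes_subset C x(3) by blast+
    then show "?s \<in> {s. s permutes S}"
      unfolding s by (simp add: permutes_compose)
  qed
  also have "\<dots> = (\<Sum>x\<in>cycles_through S v. \<Sum>t\<in>?P (fst x). ?F (snd x \<circ> t))"
    using finite_cycles_through[OF fin] fin
    by (subst sum.Sigma) (auto intro!: finite_permutations)
  also have "\<dots> = (\<Sum>(C, c)\<in>cycles_through S v. (\<Prod>i\<in>C. h i (c i)) *
    (hook_imm (S - C) (k - int (card C)) h - (-1) ^ card C * hook_imm (S - C) k h))"
  proof (rule sum.cong[OF refl])
    fix x assume "x \<in> cycles_through S v"
    then show "(\<Sum>t\<in>?P (fst x). ?F (snd x \<circ> t))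
      = (case x of (C, c) \<Rightarrow> (\<Prod>i\<in>C. h i (c i)) *
          (hook_imm (S - C) (k - int (card C)) h - (-1) ^ card C * hook_imm (S - C) k h))"
      using inner[of "fst x" "snd x"] by (simp only: prod.collapse split_beta)
  qed
  finally show ?thesis .
qed

section \<open>Digraphs\<close>

text \<open>Inside the range of k this is the character formula. For the empty matrix and k \<le> 0
  only the empty invariant set contributes, with the value (-1) ^ (-k) fixed in the definition. In
  the other cases both sides vanish.\<close>

lemma hook_immanant_eq_hook_imm:
  "hook_immanant k M = hook_imm {0..<dim_row M} k (\<lambda>i j. M $$ (i, j))"
proof -
  define m where "m = dim_row M"
  consider "1 \<le> k \<and> k \<le> int m" | "m = 0" "k \<le> 0" | "m \<noteq> 0" "k \<le> 0" | "k > int m" by linarith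
  then have "hook_immanant k M = hook_imm {0..<m} k (\<lambda>i j. M $$ (i, j))"
  proof cases
    case 1
    then have "1 \<le> nat k" "nat k \<le> m" by auto
    then have "irr_char (hook (nat k) m) s = hook_char {0..<m} s k" if "s permutes {0..<m}" for s
      using irr_char_hook[OF _ _ that] 1 by simp
    then show ?thesis
      using 1 unfolding hook_immanant_def hook_imm_def m_def[symmetric] Let_def by simp
  next
    case 2
    have "hook_char ({} :: nat set) id k = (-1) ^ nat (- k)"
    proof -
      have inv: "{A :: nat set. A \<subseteq> {} \<and> id ` A = A \<and> k \<le> int (card ({} - A))} = {{}}"
        using 2 by auto
      have "perm_restrict id {} = (id :: nat \<Rightarrow> nat)" by (auto simp: perm_restrict_def)
      then show ?thesis unfolding hook_char_def inv by simp
    qed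
    then show ?thesis
      using 2 unfolding hook_immanant_def hook_imm_def m_def[symmetric] Let_def by simp
  next
    case 3
    then have "hook_char {0..<m} s k = 0" if "s permutes {0..<m}" for s
      using that by (intro hook_char_nonpos) auto
    then show ?thesis
      using 3 unfolding hook_immanant_def hook_imm_def m_def[symmetric] Let_def by simp
  next
    case 4
    then have "hook_char {0..<m} s k = 0" for s by (intro hook_char_greater) auto
    then show ?thesis
      using 4 unfolding hook_immanant_def hook_imm_def m_def[symmetric] Let_def by simp
  qed
  then show ?thesis unfolding m_def .
qed

lemma hook_poly_eq_hook_imm:
  assumes M: "M \<in> carrier_mat m m" and f: "bij_betw f {0..<m} S"
    and h: "\<And>i j. i < m \<Longrightarrow> j < m \<Longrightarrow> h (f i) (f j) = (if i = j then x else 0) - M $$ (i, j)"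
  shows "hook_poly k M x = hook_imm S k h"
proof -
  have "hook_poly k M x = hook_imm {0..<m} k (\<lambda>i j. (x \<cdot>\<^sub>m 1\<^sub>m m - M) $$ (i, j))"
    unfolding hook_poly_def hook_immanant_eq_hook_imm using M by simp
  also have "\<dots> = hook_imm {0..<m} k (\<lambda>i j. h (f i) (f j))"
    by (rule hook_imm_cong) (use M h in auto)
  also have "\<dots> = hook_imm S k h"
    by (rule hook_imm_relabel[OF f, symmetric]) simp
  finally show ?thesis .
qed

section \<open>Matrices of a digraph and their principal submatrices, indexed by vertices\<close>

lemma bij_betw_pick:
  assumes "finite I"
  shows "bij_betw (pick I) {0..<card I} I"
proof -
  have "I \<subseteq> pick I ` {0..<card I}"
  proof
    fix i assume i: "i \<in> I"
    then have "{a \<in> I. a < i} \<subset> I" by auto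
    then have "card {a \<in> I. a < i} < card I" using assms psubset_card_mono by blast
    then show "i \<in> pick I ` {0..<card I}" 
      using pick_card_in_set[OF i] by (intro image_eqI[where x = "card {a \<in> I. a < i}"]) simp_all
  qed
  moreover have "card (pick I ` {0..<card I}) \<le> card I"
    using card_image_le[of "{0..<card I}" "pick I"] by simp
  ultimately have img: "pick I ` {0..<card I} = I"
    using card_seteq[of "pick I ` {0..<card I}" I] by simp
  then have "inj_on (pick I) {0..<card I}" by (intro eq_card_imp_inj_on) auto
  with img show ?thesis unfolding bij_betw_def by blast
qed

text \<open>The entry of x I - H. The out-degree is taken in the whole digraph even after vertices
  have been deleted, since \<open>H_del\<close> is a submatrix of H and not the matrix of a smaller
  digraph.\<close>

definition char_entry :: "real \<Rightarrow> real \<Rightarrow> ('a, 'b) pre_digraph \<Rightarrow> real \<Rightarrow> 'a \<Rightarrow> 'a \<Rightarrow> real" where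
  "char_entry \<beta> \<gamma> G x u w = (if u = w then x - \<beta> * real (out_degree G u) else 0)
     - (if (u, w) \<in> arcs_ends G then \<gamma> else 0)"

lemma H_mat_entry:
  assumes "distinct vs" "i < length vs" "j < length vs"
  shows "char_entry \<beta> \<gamma> G x (vs ! i) (vs ! j) = (if i = j then x else 0) - H_mat \<beta> \<gamma> G vs $$ (i, j)"
  using assms by (auto simp: char_entry_def H_mat_def out_deg_mat_def adj_mat_def mat_diag_def nth_eq_iff_index_eq)

lemma H_mat_carrier: "H_mat \<beta> \<gamma> G vs \<in> carrier_mat (length vs) (length vs)"
  by (simp add: H_mat_def out_deg_mat_def adj_mat_def mat_diag_def carrier_matI)

lemma hook_poly_H_mat:
  assumes "distinct vs" "set vs = verts G"
  shows "hook_poly k (H_mat \<beta> \<gamma> G vs) x = hook_imm (verts G) k (char_entry \<beta> \<gamma> G x)"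
proof (rule hook_poly_eq_hook_imm[OF H_mat_carrier])
  show "bij_betw ((!) vs) {0..<length vs} (verts G)"
    using assms by (intro bij_betw_nth) auto
qed (rule H_mat_entry[OF assms(1)])

lemma hook_poly_H_del:
  assumes "distinct vs" "set vs = verts G"
  shows "hook_poly k (H_del \<beta> \<gamma> G vs D) x = hook_imm (verts G - D) k (char_entry \<beta> \<gamma> G x)"
proof -
  define I where "I = {i. i < length vs \<and> vs ! i \<notin> D}"
  have fin: "finite I" unfolding I_def by simp
  have dims: "dim_row (H_mat \<beta> \<gamma> G vs) = length vs" "dim_col (H_mat \<beta> \<gamma> G vs) = length vs"
    using H_mat_carrier[of \<beta> \<gamma> G vs] by auto
  have I: "{i. i < length vs \<and> i \<in> I} = I" unfolding I_def by auto
  have pick: "bij_betw (pick I) {0..<card I} I" by (rule bij_betw_pick[OF fin])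
  then have pick_in: "pick I i \<in> I" if "i < card I" for i using that unfolding bij_betw_def by auto
  have pick_eq: "pick I i = pick I j \<longleftrightarrow> i = j" if "i < card I" "j < card I" for i j
    using pick that unfolding bij_betw_def inj_on_def by auto
  have "bij_betw ((!) vs) I (verts G - D)"
    unfolding bij_betw_def
  proof
    show "inj_on ((!) vs) I" using assms(1) by (auto simp: inj_on_def I_def nth_eq_iff_index_eq)
    show "(!) vs ` I = verts G - D" unfolding assms(2)[symmetric] I_def by (auto simp: in_set_conv_nth)
  qed
  then have bij: "bij_betw ((!) vs \<circ> pick I) {0..<card I} (verts G - D)"
    by (rule bij_betw_trans[OF pick])
  have car: "H_del \<beta> \<gamma> G vs D \<in> carrier_mat (card I) (card I)"
    unfolding H_del_def Let_def I_def[symmetric] by (simp add: carrier_matI dim_submatrix dims I)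
  show ?thesis
  proof (rule hook_poly_eq_hook_imm[OF car bij])
    fix i j assume ij: "i < card I" "j < card I"
    have "H_del \<beta> \<gamma> G vs D $$ (i, j) = H_mat \<beta> \<gamma> G vs $$ (pick I i, pick I j)"
      unfolding H_del_def Let_def I_def[symmetric] by (rule submatrix_index) (simp_all add: dims I ij)
    moreover have "pick I i < length vs" "pick I j < length vs"
      using pick_in[OF ij(1)] pick_in[OF ij(2)] unfolding I_def by auto
    ultimately show "char_entry \<beta> \<gamma> G x (((!) vs \<circ> pick I) i) (((!) vs \<circ> pick I) j)
      = (if i = j then x else 0) - H_del \<beta> \<gamma> G vs D $$ (i, j)"
      using H_mat_entry[OF assms(1), of "pick I i" "pick I j" \<beta> \<gamma> G x] pick_eq[OF ij] by simp
  qed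
qed

section \<open>Directed cycles as cyclic permutations of their vertices\<close>

definition cycle_arcs :: "('a, 'b) pre_digraph \<Rightarrow> 'a set \<times> ('a \<Rightarrow> 'a) \<Rightarrow> 'b set" where
  "cycle_arcs G = (\<lambda>(C, c). {e \<in> arcs G. tail G e \<in> C \<and> head G e = c (tail G e)})"

definition arc_cycles_through :: "('a, 'b) pre_digraph \<Rightarrow> 'a \<Rightarrow> ('a set \<times> ('a \<Rightarrow> 'a)) set" where
  "arc_cycles_through G v
    = {(C, c) \<in> cycles_through (verts G) v. \<forall>i\<in>C. (i, c i) \<in> arcs_ends G}"

lemma tail_cycle_arcs:
  assumes "(C, c) \<in> arc_cycles_through G v"
  shows "tail G ` cycle_arcs G (C, c) = C"
proof
  show "C \<subseteq> tail G ` cycle_arcs G (C, c)"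
  proof
    fix i assume i: "i \<in> C"
    then have "(i, c i) \<in> arcs_ends G" using assms unfolding arc_cycles_through_def by auto
    then obtain e where "e \<in> arcs G" "tail G e = i" "head G e = c i" by (rule reachableE)
    then show "i \<in> tail G ` cycle_arcs G (C, c)" using i unfolding cycle_arcs_def by auto
  qed
qed (auto simp: cycle_arcs_def)

text \<open>The tails of the arcs recover C, and the head of the arc that leaves i recovers
  \<open>c i\<close>.\<close>

lemma inj_on_cycle_arcs: "inj_on (cycle_arcs G) (arc_cycles_through G v)"
proof (rule inj_onI)
  fix x y assume x: "x \<in> arc_cycles_through G v" and y: "y \<in> arc_cycles_through G v"
    and eq: "cycle_arcs G x = cycle_arcs G y"
  obtain C c D d where xy: "x = (C, c)" "y = (D, d)" by fastforce
  have CD: "C = D" using tail_cycle_arcs x y eq unfolding xy by metis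
  have perm: "c permutes C" "d permutes C"
    using x y CD unfolding xy arc_cycles_through_def cycles_through_def by auto
  have "c i = d i" for i
  proof (cases "i \<in> C")
    case True
    then have "(i, c i) \<in> arcs_ends G" using x unfolding xy arc_cycles_through_def by auto
    then obtain e where e: "e \<in> arcs G" "tail G e = i" "head G e = c i" by (rule reachableE)
    then have "e \<in> cycle_arcs G x" using True unfolding xy cycle_arcs_def by auto
    then have "e \<in> cycle_arcs G y" using eq by simp
    then show ?thesis using e unfolding xy cycle_arcs_def by auto
  next
    case False
    then show ?thesis using perm by (simp add: permutes_not_in)
  qed
  then show "x = y" using CD unfolding xy by auto
qed

lemma cyclic_on_cycle_of_list:
  assumes "distinct ts" "ts \<noteq> []"
  shows "cyclic_on (cycle_of_list ts) (set ts)"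
proof -
  let ?c = "cycle_of_list ts"
  have pos: "0 < length ts" using assms(2) by simp
  have hd: "ts ! 0 \<in> set ts" using pos by (rule nth_mem)
  have "set ts \<subseteq> orbit ?c (ts ! 0)"
  proof
    fix y assume "y \<in> set ts"
    then obtain n where n: "n < length ts" "y = ts ! n" by (auto simp: in_set_conv_nth)
    \<comment> \<open>The cycle acts on its own list by rotation, so n steps lead from the first
      entry to the n-th.\<close>
    have "(?c ^^ n) (ts ! 0) = map (?c ^^ n) ts ! 0" using pos by simp
    also have "\<dots> = rotate n ts ! 0" unfolding cyclic_rotation[OF assms(1)] ..
    also have "\<dots> = ts ! n" using n pos by (simp add: nth_rotate)
    finally have "y = (?c ^^ n) (ts ! 0)" using n(2) by simp
    then show "y \<in> orbit ?c (ts ! 0)"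
      unfolding orbit_altdef_permutation[OF permutation_of_cycle] by blast
  qed
  moreover have "orbit ?c (ts ! 0) \<subseteq> set ts"
    using permutes_orbit_subset[OF cycle_permutes hd] .
  ultimately show ?thesis unfolding cyclic_on_def using hd by blast
qed

context digraph
begin

lemma arc_eqI: "e \<in> arcs G \<Longrightarrow> e' \<in> arcs G \<Longrightarrow> tail G e = tail G e' \<Longrightarrow> head G e = head G e' \<Longrightarrow> e = e'"
  using no_multi_arcs unfolding arc_to_ends_def by simp

lemma cas_funpow:
  assumes "\<And>i. i \<in> C \<Longrightarrow> tail G (a i) = i \<and> head G (a i) = c i" "\<And>i. i \<in> C \<Longrightarrow> c i \<in> C" "u \<in> C"
  shows "cas u (map (\<lambda>n. a ((c ^^ n) u)) [0..<n]) ((c ^^ n) u)"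
  using assms(3)
proof (induction n arbitrary: u)
  case (Suc n)
  have "map (\<lambda>n. a ((c ^^ n) u)) [0..<Suc n] = a u # map (\<lambda>n. a ((c ^^ n) (c u))) [0..<n]"
    unfolding upt_conv_Cons[OF zero_less_Suc] map_Suc_upt[symmetric]
    by (simp add: funpow_swap1)
  then show ?case using Suc.IH[of "c u"] Suc.prems assms(1,2) by (simp add: funpow_swap1)
qed simp

text \<open>An arc a i is chosen from every i to \<open>c i\<close>; following c from v for
  \<open>least_power c v\<close> steps closes the walk.\<close>

lemma cycle_arcs_in_cycles_at_vertex:
  assumes "x \<in> arc_cycles_through G v"
  shows "cycle_arcs G x \<in> cycles_at_vertex G v"
proof -
  obtain C c where x: "x = (C, c)" by fastforce
  have C: "C \<subseteq> verts G" "v \<in> C" "c permutes C" "orbit c v = C" "\<And>i. i \<in> C \<Longrightarrow> (i, c i) \<in> arcs_ends G"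
    using assms unfolding x arc_cycles_through_def cycles_through_def by auto
  have finC: "finite C" using C(1) finite_verts finite_subset by blast
  have perm: "permutation c" using C(3) finC permutation_permutes by blast
  have "\<forall>i\<in>C. \<exists>e. e \<in> arcs G \<and> tail G e = i \<and> head G e = c i"
    using C(5) by (metis reachableE)
  then obtain a where a: "\<And>i. i \<in> C \<Longrightarrow> a i \<in> arcs G \<and> tail G (a i) = i \<and> head G (a i) = c i"
    by metis
  have c_in: "c i \<in> C" if "i \<in> C" for i using permutes_in_image[OF C(3)] that by simp
  define L where "L = support c v"
  have setL: "set L = C"
    unfolding L_def using support_set[OF perm, of v] orbit_altdef_permutation[OF perm, of v] C(4) by auto
  have distL: "distinct L" unfolding L_def by (rule cycle_of_permutation[OF perm])
  define p where "p = map a L"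
  have len: "0 < least_power c v" and pow: "(c ^^ least_power c v) v = v"
    using least_power_of_permutation[OF perm] by auto
  have p_eq: "p = map (\<lambda>n. a ((c ^^ n) v)) [0..<least_power c v]"
    unfolding p_def L_def by simp
  have cas: "cas v p v"
    using cas_funpow[of C a c v "least_power c v"] a c_in C(2) unfolding p_eq pow by simp
  have ne: "p \<noteq> []" using len unfolding p_eq by simp
  have heads: "map (head G) p = map c L" using a setL unfolding p_def by auto
  have "awalk v p v"
    unfolding awalk_def using cas C(1,2) a setL unfolding p_def by auto
  moreover have "distinct (tl (awalk_verts v p))"
  proof -
    \<comment> \<open>Without its first vertex the vertex list of the walk is the list of heads,
      i.e. the image of L under the injective c.\<close>
    have "distinct (map c L)"
      using distL inj_on_subset[OF permutes_inj[OF C(3)] subset_UNIV] by (simp add: distinct_map)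
    then show ?thesis unfolding awalk_verts_conv'[OF cas] heads[symmetric] using ne by simp
  qed
  ultimately have "cycle p" unfolding cycle_def using ne by blast
  moreover have "set p = cycle_arcs G x"
  proof
    show "set p \<subseteq> cycle_arcs G x" using a setL unfolding p_def x cycle_arcs_def by auto
    show "cycle_arcs G x \<subseteq> set p"
    proof
      fix e assume "e \<in> cycle_arcs G x"
      then have e: "e \<in> arcs G" "tail G e \<in> C" "head G e = c (tail G e)"
        unfolding x cycle_arcs_def by auto
      \<comment> \<open>Without parallel arcs the ends determine the arc, so the choice a misses
        none.\<close>
      then have "e = a (tail G e)" using a[OF e(2)] by (intro arc_eqI) auto
      then show "e \<in> set p" using e(2) setL unfolding p_def by auto
    qed
  qed
  moreover have "v \<in> cycle_verts G (cycle_arcs G x)"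
    unfolding cycle_verts_def x using tail_cycle_arcs assms C(2) unfolding x by metis
  ultimately show ?thesis unfolding cycles_at_vertex_def dicycles_def by blast
qed

lemma cycles_at_vertex_subset: "cycles_at_vertex G v \<subseteq> cycle_arcs G ` arc_cycles_through G v"
proof
  fix A assume A: "A \<in> cycles_at_vertex G v"
  then obtain p where p: "A = set p" "cycle p" and v: "v \<in> tail G ` set p"
    unfolding cycles_at_vertex_def dicycles_def cycle_verts_def by blast
  obtain u where u: "awalk u p u" "distinct (tl (awalk_verts u p))" "p \<noteq> []"
    using p(2) unfolding cycle_def by blast
  have cas: "cas u p u" and arcs: "set p \<subseteq> arcs G" using u(1) unfolding awalk_def by auto
  define ts where "ts = map (tail G) p"
  \<comment> \<open>In a closed walk each head is the next tail. Hence the cyclic permutation of the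
    list of tails sends every tail to the head of its arc.\<close>
  have hds: "map (head G) p = rotate1 ts"
  proof -
    have "tail G (hd p) = u" using cas u(3) by (simp add: cas_simp)
    moreover have "head G (last p) = u" using awlast_if_cas[OF cas] u(3) by (simp add: awalk_verts_conv)
    moreover have "tail G (hd p) # map (head G) p = map (tail G) p @ [head G (last p)]"
      using awalk_verts_conv'[OF cas] awalk_verts_conv[of u p] u(3) by simp
    ultimately show ?thesis unfolding ts_def using u(3) by (cases p) auto
  qed
  have "distinct (map (head G) p)" using u(2,3) unfolding awalk_verts_conv'[OF cas] by simp
  then have dist: "distinct ts" unfolding hds by simp
  have ne: "ts \<noteq> []" using u(3) unfolding ts_def by simp
  define c where "c = cycle_of_list ts"
  have "map c ts = map (head G) p"
    using cyclic_rotation[OF dist, of 1] unfolding c_def hds by simp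
  then have c_tail: "c (tail G e) = head G e" if "e \<in> set p" for e
    using that unfolding ts_def by simp
  define C where "C = set ts"
  have C_eq: "C = tail G ` set p" unfolding C_def ts_def by simp
  have vC: "v \<in> C" using v unfolding C_eq .
  have "orbit c v = C"
    using cyclic_on_cycle_of_list[OF dist ne] vC orbit_cyclic_eq3 unfolding c_def C_def by metis
  moreover have "c permutes C" unfolding c_def C_def by (rule cycle_permutes)
  moreover have "C \<subseteq> verts G" unfolding C_eq using arcs by auto
  moreover have "(i, c i) \<in> arcs_ends G" if "i \<in> C" for i
    using that c_tail arcs unfolding C_eq arcs_ends_conv by auto
  ultimately have "(C, c) \<in> arc_cycles_through G v"
    unfolding arc_cycles_through_def cycles_through_def using vC by auto
  moreover have "cycle_arcs G (C, c) = A"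
  proof
    show "A \<subseteq> cycle_arcs G (C, c)" unfolding p(1) cycle_arcs_def C_eq using c_tail arcs by auto
    show "cycle_arcs G (C, c) \<subseteq> A"
    proof
      fix e assume "e \<in> cycle_arcs G (C, c)"
      then have e: "e \<in> arcs G" "tail G e \<in> C" "head G e = c (tail G e)" unfolding cycle_arcs_def by auto
      then obtain e' where e': "e' \<in> set p" "tail G e = tail G e'" unfolding C_eq by blast
      then have "e = e'" using e c_tail[OF e'(1)] arcs by (intro arc_eqI) auto
      then show "e \<in> A" using e'(1) p(1) by simp
    qed
  qed
  ultimately show "A \<in> cycle_arcs G ` arc_cycles_through G v" by blast
qed

lemma cycles_at_vertex_eq: "cycles_at_vertex G v = cycle_arcs G ` arc_cycles_through G v"
  using cycles_at_vertex_subset cycle_arcs_in_cycles_at_vertex by blast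

lemma finite_cycles_at_vertex: "finite (cycles_at_vertex G v)"
proof -
  have "arc_cycles_through G v \<subseteq> cycles_through (verts G) v" unfolding arc_cycles_through_def by auto
  then show ?thesis unfolding cycles_at_vertex_eq
    using finite_cycles_through[OF finite_verts] finite_subset by blast
qed

text \<open>The cycles of \<open>hook_imm_expand\<close> fall into three classes: the fixed point v
  yields the diagonal term, cycles that use a non-arc have weight 0, and directed cycles of length l
  have weight (-\<gamma>) ^ l.\<close>

lemma hook_imm_expand_vertex:
  fixes \<beta> \<gamma> x :: real
  assumes v: "v \<in> verts G"
  defines "h \<equiv> char_entry \<beta> \<gamma> G x"
  shows "hook_imm (verts G) k h = (x - \<beta> * real (out_degree G v)) *
      (hook_imm (verts G - {v}) (k - 1) h + hook_imm (verts G - {v}) k h)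
    + (\<Sum>A\<in>cycles_at_vertex G v. \<gamma> ^ card (cycle_verts G A) *
       ((-1) ^ card (cycle_verts G A) *
          hook_imm (verts G - cycle_verts G A) (k - int (card (cycle_verts G A))) h
        - hook_imm (verts G - cycle_verts G A) k h))"
proof -
  let ?X = "cycles_through (verts G) v"
  let ?g = "\<lambda>(C, c). (\<Prod>i\<in>C. h i (c i)) *
    (hook_imm (verts G - C) (k - int (card C)) h - (-1) ^ card C * hook_imm (verts G - C) k h)"
  let ?t = "\<lambda>C. \<gamma> ^ card C * ((-1) ^ card C * hook_imm (verts G - C) (k - int (card C)) h
    - hook_imm (verts G - C) k h)"
  have no_loop: "(i, i) \<notin> arcs_ends G" for i using adj_not_same by blast
  have fixed: "({v}, id) \<in> ?X"
    unfolding cycles_through_def using v by (simp add: permutes_id orbit_eq_singleton_iff)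
  have fin: "finite ?X" by (rule finite_cycles_through[OF finite_verts])
  have sub: "arc_cycles_through G v \<subseteq> ?X - {({v}, id)}"
    unfolding arc_cycles_through_def using no_loop by auto
  \<comment> \<open>A fixed point anywhere on the single orbit would make the cycle trivial. So
    nontrivial cycles meet only off-diagonal entries.\<close>
  have ne: "c i \<noteq> i" if x: "(C, c) \<in> ?X - {({v}, id)}" and i: "i \<in> C" for C c i
  proof
    assume ci: "c i = i"
    have C: "v \<in> C" "c permutes C" "orbit c v = C" using x unfolding cycles_through_def by auto
    have "cyclic_on c C" using C unfolding cyclic_on_def by blast
    then have "orbit c i = C" using i by (rule orbit_cyclic_eq3)
    moreover have "orbit c i = {i}" using ci by (simp add: orbit_eq_singleton_iff)
    ultimately have "C = {v}" using C(1) by auto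
    moreover have "c = id" using C(2) \<open>C = {v}\<close> by (simp add: permutes_sing)
    ultimately show False using x by simp
  qed
  have h_ne: "h i j = - (if (i, j) \<in> arcs_ends G then \<gamma> else 0)" if "i \<noteq> j" for i j
    using that unfolding h_def char_entry_def by simp
  have zero: "?g y = 0" if y: "y \<in> ?X - {({v}, id)} - arc_cycles_through G v" for y
  proof -
    obtain C c where Cc: "y = (C, c)" by fastforce
    have "C \<subseteq> verts G" using y unfolding Cc cycles_through_def by auto
    then have finC: "finite C" using finite_verts finite_subset by blast
    obtain i where i: "i \<in> C" "(i, c i) \<notin> arcs_ends G"
      using y unfolding Cc arc_cycles_through_def by auto
    have "h i (c i) = 0" using h_ne[of i "c i"] ne[of C c i] y i unfolding Cc by auto
    then have "(\<Prod>i\<in>C. h i (c i)) = 0" using finC i(1) by (intro prod_zero) auto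
    then show ?thesis unfolding Cc by simp
  qed
  have val: "?g y = ?t (cycle_verts G (cycle_arcs G y))" if y: "y \<in> arc_cycles_through G v" for y
  proof -
    obtain C c where Cc: "y = (C, c)" by fastforce
    have verts: "cycle_verts G (cycle_arcs G y) = C"
      using tail_cycle_arcs y unfolding Cc cycle_verts_def by metis
    have "h i (c i) = - \<gamma>" if i: "i \<in> C" for i
    proof -
      have "c i \<noteq> i" using ne[of C c i] sub y i unfolding Cc by blast
      moreover have "(i, c i) \<in> arcs_ends G" using y i unfolding Cc arc_cycles_through_def by auto
      ultimately show ?thesis using h_ne[of i "c i"] by simp
    qed
    then have "(\<Prod>i\<in>C. h i (c i)) = (- \<gamma>) ^ card C" by simp
    moreover have "(- \<gamma>) ^ card C = (-1) ^ card C * \<gamma> ^ card C" by (rule power_minus)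
    \<comment> \<open>The sign of the weight cancels the factor (-1) ^ l of the second term and
      moves to the first one.\<close>
    moreover have "(-1) ^ card C * (-1) ^ card C = (1 :: real)"
      by (simp add: power_mult_distrib[symmetric])
    ultimately show ?thesis unfolding Cc prod.case verts[unfolded Cc]
      by (simp add: algebra_simps)
  qed
  have "hook_imm (verts G) k h = sum ?g ?X" by (rule hook_imm_expand[OF finite_verts v])
  also have "\<dots> = ?g ({v}, id) + sum ?g (?X - {({v}, id)})" by (rule sum.remove[OF fin fixed])
  also have "sum ?g (?X - {({v}, id)}) = sum ?g (arc_cycles_through G v)"
    by (rule sum.mono_neutral_right) (use fin sub zero in auto)
  also have "\<dots> = (\<Sum>y\<in>arc_cycles_through G v. ?t (cycle_verts G (cycle_arcs G y)))"
    by (rule sum.cong[OF refl val])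
  also have "\<dots> = (\<Sum>A\<in>cycles_at_vertex G v. ?t (cycle_verts G A))"
    unfolding cycles_at_vertex_eq sum.reindex[OF inj_on_cycle_arcs] by simp
  \<comment> \<open>Here l = 1 turns the difference into a sum, and the diagonal entry has no
    \<gamma> because there are no loops.\<close>
  also have "?g ({v}, id) = (x - \<beta> * real (out_degree G v)) *
      (hook_imm (verts G - {v}) (k - 1) h + hook_imm (verts G - {v}) k h)"
    using no_loop[of v] by (simp add: h_def char_entry_def)
  finally show ?thesis .
qed

end

section \<open>Deletion of an arc\<close>

lemma dicycles_del_arc:
  "dicycles (pre_digraph.del_arc G e) = {C \<in> dicycles G. e \<notin> C}"
proof -
  let ?G = "pre_digraph.del_arc G e"
  have simps: "tail ?G = tail G" "head ?G = head G" "verts ?G = verts G" "arcs ?G = arcs G - {e}"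
    by (simp_all add: pre_digraph.del_arc_simps)
  have verts: "pre_digraph.awalk_verts ?G u p = pre_digraph.awalk_verts G u p" for u p
    unfolding pre_digraph.awalk_verts_conv simps ..
  have cas: "pre_digraph.cas ?G u p w = pre_digraph.cas G u p w" for u p w
    by (induction p arbitrary: u) (simp_all add: pre_digraph.cas.simps simps)
  have "pre_digraph.cycle ?G p \<longleftrightarrow> pre_digraph.cycle G p \<and> e \<notin> set p" for p
    unfolding pre_digraph.cycle_def pre_digraph.awalk_def verts cas simps by blast
  then show ?thesis unfolding dicycles_def by auto
qed

lemma digraph_del_arc:
  assumes "digraph G"
  shows "digraph (pre_digraph.del_arc G e)"
proof -
  interpret digraph G by fact
  interpret D: fin_digraph "del_arc e" by (rule fin_digraph_del_arc)
  show ?thesis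
    by unfold_locales (use no_loops no_multi_arcs in \<open>auto simp: arc_to_ends_def\<close>)
qed

theorem theorem1p3:
  fixes G :: "('a, 'b) pre_digraph" and vs :: "'a list"
    and \<beta> \<gamma> x :: real and k :: int
  assumes "digraph G" and "distinct vs" and "set vs = verts G"
  shows
    "(\<forall>v\<in>verts G.
        hook_poly k (H_mat \<beta> \<gamma> G vs) x =
          (x - \<beta> * real (out_degree G v)) *
            (hook_poly (k - 1) (H_del \<beta> \<gamma> G vs {v}) x + hook_poly k (H_del \<beta> \<gamma> G vs {v}) x)
          + (\<Sum>C\<in>cycles_at_vertex G v. \<gamma> ^ card (cycle_verts G C) *
               ((-1) ^ card (cycle_verts G C) *
                  hook_poly (k - int (card (cycle_verts G C))) (H_del \<beta> \<gamma> G vs (cycle_verts G C)) x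
                - hook_poly k (H_del \<beta> \<gamma> G vs (cycle_verts G C)) x)))
     \<and>
     (\<forall>e v u. e \<in> arcs G \<and> tail G e = v \<and> head G e = u \<longrightarrow>
        hook_poly k (H_mat \<beta> \<gamma> G vs) x =
          hook_poly k (H_mat \<beta> \<gamma> (pre_digraph.del_arc G e) vs) x
          - \<beta> * (hook_poly k (H_del \<beta> \<gamma> (pre_digraph.del_arc G e) vs {v}) x
                 + hook_poly (k - 1) (H_del \<beta> \<gamma> (pre_digraph.del_arc G e) vs {v}) x)
          + (\<Sum>C\<in>cycles_at_arc G e. \<gamma> ^ card (cycle_verts G C) *
               ((-1) ^ card (cycle_verts G C) *
                  hook_poly (k - int (card (cycle_verts G C))) (H_del \<beta> \<gamma> G vs (cycle_verts G C)) x
                - hook_poly k (H_del \<beta> \<gamma> G vs (cycle_verts G C)) x)))"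
proof (intro conjI ballI allI impI)
  note poly = hook_poly_H_mat[OF assms(2,3)] hook_poly_H_del[OF assms(2,3)]
  fix v assume v: "v \<in> verts G"
  show "hook_poly k (H_mat \<beta> \<gamma> G vs) x =
      (x - \<beta> * real (out_degree G v)) *
        (hook_poly (k - 1) (H_del \<beta> \<gamma> G vs {v}) x + hook_poly k (H_del \<beta> \<gamma> G vs {v}) x)
      + (\<Sum>C\<in>cycles_at_vertex G v. \<gamma> ^ card (cycle_verts G C) *
           ((-1) ^ card (cycle_verts G C) *
              hook_poly (k - int (card (cycle_verts G C))) (H_del \<beta> \<gamma> G vs (cycle_verts G C)) x
            - hook_poly k (H_del \<beta> \<gamma> G vs (cycle_verts G C)) x))"
    unfolding poly by (rule digraph.hook_imm_expand_vertex[OF assms(1) v])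
next
  fix e v u assume "e \<in> arcs G \<and> tail G e = v \<and> head G e = u"
  then have e: "e \<in> arcs G" "tail G e = v" by auto
  interpret digraph G by fact
  let ?G = "del_arc e"
  have verts: "set vs = verts ?G" using assms(3) by simp
  note poly = hook_poly_H_mat[OF assms(2,3)] hook_poly_H_del[OF assms(2,3)]
    hook_poly_H_mat[OF assms(2) verts] hook_poly_H_del[OF assms(2) verts]
  let ?h = "char_entry \<beta> \<gamma> G x" and ?h' = "char_entry \<beta> \<gamma> ?G x"
  have v: "v \<in> verts G" using e by auto
  have deg: "real (out_degree ?G v) = real (out_degree G v) - 1"
  proof -
    have "e \<in> out_arcs G v" using e by simp
    then have "out_degree G v \<noteq> 0" unfolding out_degree_def using finite_out_arcs by auto
    then show ?thesis using e by (simp add: out_degree_del_arc_iff)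
  qed
  \<comment> \<open>Deleting e changes only row v: its out-degree and one adjacency entry. All
    submatrices that omit v therefore agree.\<close>
  have h_eq: "?h' i j = ?h i j" if "i \<noteq> v" for i j
  proof -
    have "(i, j) \<in> arcs_ends ?G \<longleftrightarrow> (i, j) \<in> arcs_ends G"
      using that e(2) unfolding arcs_ends_conv by auto
    moreover have "out_degree ?G i = out_degree G i"
      using that e(2) by (simp add: out_degree_del_arc_iff)
    ultimately show ?thesis unfolding char_entry_def by (simp only:)
  qed
  have imm: "hook_imm (verts G - D) k' ?h' = hook_imm (verts G - D) k' ?h" if "v \<in> D" for D k'
    by (rule hook_imm_cong) (use that in \<open>auto intro!: h_eq\<close>)
  let ?t = "\<lambda>h C. \<gamma> ^ card (cycle_verts G C) * ((-1) ^ card (cycle_verts G C) *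
      hook_imm (verts G - cycle_verts G C) (k - int (card (cycle_verts G C))) h
      - hook_imm (verts G - cycle_verts G C) k h)"
  have cv: "cycle_verts ?G = cycle_verts G" unfolding cycle_verts_def by (simp add: fun_eq_iff)
  \<comment> \<open>A cycle that contains e passes through its tail v, and the cycles at v that
    avoid e are those of the smaller digraph.\<close>
  have split: "cycles_at_vertex G v = cycles_at_vertex ?G v \<union> cycles_at_arc G e"
    "cycles_at_vertex ?G v \<inter> cycles_at_arc G e = {}"
    using e(2) unfolding cycles_at_vertex_def cycles_at_arc_def dicycles_del_arc cv
    by (auto simp: cycle_verts_def)
  have "finite (cycles_at_vertex ?G v)" "finite (cycles_at_arc G e)"
    using finite_cycles_at_vertex[of v] unfolding split(1) by auto
  then have sum: "sum (?t ?h) (cycles_at_vertex G v)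
      = sum (?t ?h) (cycles_at_vertex ?G v) + sum (?t ?h) (cycles_at_arc G e)"
    unfolding split(1) using split(2) by (rule sum.union_disjoint)
  have "sum (?t ?h') (cycles_at_vertex ?G v) = sum (?t ?h) (cycles_at_vertex ?G v)"
  proof (rule sum.cong[OF refl])
    fix C assume "C \<in> cycles_at_vertex ?G v"
    then have "v \<in> cycle_verts G C" unfolding cycles_at_vertex_def cv by blast
    then show "?t ?h' C = ?t ?h C" by (simp add: imm)
  qed
  \<comment> \<open>The out-degree of v drops by one, so the diagonal coefficient grows by \<beta>.
    Besides the cycles through e this is the whole difference between the two expansions.\<close>
  then have 1: "hook_imm (verts G) k ?h' = (x - \<beta> * (real (out_degree G v) - 1)) *
      (hook_imm (verts G - {v}) (k - 1) ?h + hook_imm (verts G - {v}) k ?h)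
      + sum (?t ?h) (cycles_at_vertex ?G v)"
    using digraph.hook_imm_expand_vertex[OF digraph_del_arc[OF assms(1)], of v e k \<beta> \<gamma> x] v
    by (simp add: cv imm deg)
  have 2: "hook_imm (verts G) k ?h = (x - \<beta> * real (out_degree G v)) *
      (hook_imm (verts G - {v}) (k - 1) ?h + hook_imm (verts G - {v}) k ?h)
      + sum (?t ?h) (cycles_at_vertex G v)"
    by (rule hook_imm_expand_vertex[OF v])
  have "hook_imm (verts G) k ?h = hook_imm (verts G) k ?h'
      - \<beta> * (hook_imm (verts G - {v}) k ?h' + hook_imm (verts G - {v}) (k - 1) ?h')
      + sum (?t ?h) (cycles_at_arc G e)"
    unfolding 1 2 sum by (simp add: imm algebra_simps)
  then show "hook_poly k (H_mat \<beta> \<gamma> G vs) x =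
      hook_poly k (H_mat \<beta> \<gamma> ?G vs) x
      - \<beta> * (hook_poly k (H_del \<beta> \<gamma> ?G vs {v}) x + hook_poly (k - 1) (H_del \<beta> \<gamma> ?G vs {v}) x)
      + (\<Sum>C\<in>cycles_at_arc G e. \<gamma> ^ card (cycle_verts G C) *
           ((-1) ^ card (cycle_verts G C) *
              hook_poly (k - int (card (cycle_verts G C))) (H_del \<beta> \<gamma> G vs (cycle_verts G C)) x
            - hook_poly k (H_del \<beta> \<gamma> G vs (cycle_verts G C)) x))"
    unfolding poly verts_del_arc .
qed

end
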